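(* Let $\mathbb{A}$ be a double category with chosen companions, and consider horizontal arrows $f\colon A\to B$, $g\colon C\to D$ and vertical arrows $v\colon A\nrightarrow C$, $w\colon B\nrightarrow D$ of $\mathbb{A}$. (1) If $x\colon C\nrightarrow A$ is left adjoint to $v$ and $y\colon D\nrightarrow B$ is left adjoint to $w$, then there is a bijection between cells $\alpha$ with top $f$, left $v$, right $w$, bottom $g$, and retrocells $\beta$ with top $g$, left $x$, right $y$, bottom $f$. (2) If $h\colon B\to A$ is left adjoint to $f$ and $k\colon D\to C$ is left adjoint to $g$, then there is a bijection between cells $\alpha$ with top $f$, left $v$, right $w$, bottom $g$, and retrocells $\gamma$ with top $h$, left $w$, right $v$, bottom $k$.
   Context: Double categories. A double category $\mathbb{A}$ has objects, horizontal arrows (composed strictly: composite $gf$, identity $1_A$), vertical arrows $v\colon A\nrightarrow C$ (composite $w\bullet v$ meaning $v$ first, identity $\mathrm{id}_A$; vertical composition is associative up to coherent isomorphism, vertical identities are taken strict) and cells. A cell has a top $f\colon A\to B$, a bottom $g\colon C\to D$ (horizontal arrows), a left side $v\colon A\nrightarrow C$ and a right side $w\colon B\nrightarrow D$ (vertical arrows). $\alpha\mid\beta$ denotes horizontal pasting ($\alpha$ left of $\beta$) and $\frac{\alpha}{\beta}$ vertical pasting ($\alpha$ above $\beta$). A globular cell $v\Rightarrow w$ is a cell with left $v$, right $w$ and identity top and bottom; globular cells are the 2-cells of the vertical bicategory $\mathcal{V}ert\,\mathbb{A}$. Cells with identity vertical sides, going from their top to their bottom, are the 2-cells of the 2-category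 $\mathcal{H}or\,\mathbb{A}$ of horizontal arrows. Horizontal arrows are adjoint if they are so in $\mathcal{H}or\,\mathbb{A}$; vertical arrows are adjoint if they are so in $\mathcal{V}ert\,\mathbb{A}$. Companions. A companion of $f\colon A\to B$ is a vertical arrow $f_*\colon A\nrightarrow B$ with binding cells $\psi_f$ (top $1_A$, left $\mathrm{id}_A$, right $f_*$, bottom $f$) and $\chi_f$ (top $f$, left $f_*$, right $\mathrm{id}_B$, bottom $1_B$) with $\psi_f\mid\chi_f=\mathrm{id}_f$ (vertical identity cell on $f$) and $\frac{\psi_f}{\chi_f}=1_{f_*}$ (horizontal identity cell on $f_*$). The chosen companion of $1_A$ is $\mathrm{id}_A$. Retrocells. A retrocell with top $f\colon A\to B$, left $v\colon A\nrightarrow C$, right $w\colon B\nrightarrow D$, bottom $g\colon C\to D$ is a globular cell $w\bullet f_*\Rightarrow g_*\bullet v$ of $\mathbb{A}$. *)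

theory Defs
  imports Main
begin

text \<open>
  Double categories that are strict in the horizontal direction and weakly associative, with
  strict identities, in the vertical direction.  Composites are total functions whose values are
  constrained only on composable arguments.  Both \<open>hcomp\<close> and \<open>vcomp\<close> are written in
  applicative order (the second argument comes first), whereas the pastings are written in
  geometric order: \<open>\<alpha> \<parallel> \<beta>\<close> is \<open>\<alpha>\<close> left of \<open>\<beta>\<close>, and \<open>\<alpha> \<div> \<beta>\<close> is \<open>\<alpha>\<close> above \<open>\<beta>\<close>.

  \<open>hcell f\<close> is the vertical identity cell on a horizontal arrow \<open>f\<close>; \<open>vcell v\<close> is the horizontal
  identity cell on a vertical arrow \<open>v\<close>.  \<open>vassoc w v u\<close> is the associator
  \<open>(w \<bullet> v) \<bullet> u \<Rightarrow> w \<bullet> (v \<bullet> u)\<close> and \<open>vassoc_inv w v u\<close> its inverse.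
\<close>

record ('o, 'h, 'v, 'c) double_cat =
  Obj :: "'o set"
  Hor :: "'h set"
  Ver :: "'v set"
  Cells :: "'c set"
  hdom :: "'h \<Rightarrow> 'o"
  hcod :: "'h \<Rightarrow> 'o"
  vdom :: "'v \<Rightarrow> 'o"
  vcod :: "'v \<Rightarrow> 'o"
  ctop :: "'c \<Rightarrow> 'h"
  cleft :: "'c \<Rightarrow> 'v"
  cright :: "'c \<Rightarrow> 'v"
  cbot :: "'c \<Rightarrow> 'h"
  hid :: "'o \<Rightarrow> 'h"
  hcomp :: "'h \<Rightarrow> 'h \<Rightarrow> 'h"  (infixr \<open>\<cdot>\<index>\<close> 75)
  vid :: "'o \<Rightarrow> 'v"
  vcomp :: "'v \<Rightarrow> 'v \<Rightarrow> 'v"  (infixr \<open>\<bullet>\<index>\<close> 75)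
  hcell :: "'h \<Rightarrow> 'c"
  vcell :: "'v \<Rightarrow> 'c"
  hpaste :: "'c \<Rightarrow> 'c \<Rightarrow> 'c"  (infixl \<open>\<parallel>\<index>\<close> 65)
  vpaste :: "'c \<Rightarrow> 'c \<Rightarrow> 'c"  (infixl \<open>\<div>\<index>\<close> 70)
  vassoc :: "'v \<Rightarrow> 'v \<Rightarrow> 'v \<Rightarrow> 'c"
  vassoc_inv :: "'v \<Rightarrow> 'v \<Rightarrow> 'v \<Rightarrow> 'c"

definition harr :: "('o, 'h, 'v, 'c, 'm) double_cat_scheme \<Rightarrow> 'h \<Rightarrow> 'o \<Rightarrow> 'o \<Rightarrow> bool" where
  "harr \<AA> f A B \<longleftrightarrow> f \<in> Hor \<AA> \<and> hdom \<AA> f = A \<and> hcod \<AA> f = B"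

definition varr :: "('o, 'h, 'v, 'c, 'm) double_cat_scheme \<Rightarrow> 'v \<Rightarrow> 'o \<Rightarrow> 'o \<Rightarrow> bool" where
  "varr \<AA> v A C \<longleftrightarrow> v \<in> Ver \<AA> \<and> vdom \<AA> v = A \<and> vcod \<AA> v = C"

text \<open>Boundaries are always listed in the order top, left, right, bottom.\<close>

definition cell ::
  "('o, 'h, 'v, 'c, 'm) double_cat_scheme \<Rightarrow> 'c \<Rightarrow> 'h \<Rightarrow> 'v \<Rightarrow> 'v \<Rightarrow> 'h \<Rightarrow> bool" where
  "cell \<AA> \<alpha> f v w g \<longleftrightarrow>
     \<alpha> \<in> Cells \<AA> \<and> ctop \<AA> \<alpha> = f \<and> cleft \<AA> \<alpha> = v \<and> cright \<AA> \<alpha> = w \<and> cbot \<AA> \<alpha> = g"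

definition globular :: "('o, 'h, 'v, 'c, 'm) double_cat_scheme \<Rightarrow> 'c \<Rightarrow> 'v \<Rightarrow> 'v \<Rightarrow> bool" where
  "globular \<AA> \<alpha> v w \<longleftrightarrow> cell \<AA> \<alpha> (hid \<AA> (vdom \<AA> v)) v w (hid \<AA> (vcod \<AA> v))"

definition hor_2cell :: "('o, 'h, 'v, 'c, 'm) double_cat_scheme \<Rightarrow> 'c \<Rightarrow> 'h \<Rightarrow> 'h \<Rightarrow> bool" where
  "hor_2cell \<AA> \<alpha> f g \<longleftrightarrow> cell \<AA> \<alpha> f (vid \<AA> (hdom \<AA> f)) (vid \<AA> (hcod \<AA> f)) g"

locale double_category =
  fixes \<AA> :: "('o, 'h, 'v, 'c, 'm) double_cat_scheme" (structure)
  assumes harr_obj: "harr \<AA> f A B \<Longrightarrow> A \<in> Obj \<AA> \<and> B \<in> Obj \<AA>"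
    and hid_arr: "A \<in> Obj \<AA> \<Longrightarrow> harr \<AA> (hid \<AA> A) A A"
    and hcomp_arr: "\<lbrakk>harr \<AA> f A B; harr \<AA> g B C\<rbrakk> \<Longrightarrow> harr \<AA> (g \<cdot> f) A C"
    and hcomp_hid_right: "harr \<AA> f A B \<Longrightarrow> f \<cdot> hid \<AA> A = f"
    and hcomp_hid_left: "harr \<AA> f A B \<Longrightarrow> hid \<AA> B \<cdot> f = f"
    and hcomp_assoc:
      "\<lbrakk>harr \<AA> f A B; harr \<AA> g B C; harr \<AA> h C D\<rbrakk> \<Longrightarrow> (h \<cdot> g) \<cdot> f = h \<cdot> (g \<cdot> f)"
    and varr_obj: "varr \<AA> v A C \<Longrightarrow> A \<in> Obj \<AA> \<and> C \<in> Obj \<AA>"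
    and vid_arr: "A \<in> Obj \<AA> \<Longrightarrow> varr \<AA> (vid \<AA> A) A A"
    and vcomp_arr: "\<lbrakk>varr \<AA> v A B; varr \<AA> w B C\<rbrakk> \<Longrightarrow> varr \<AA> (w \<bullet> v) A C"
    and vcomp_vid_right: "varr \<AA> v A C \<Longrightarrow> v \<bullet> vid \<AA> A = v"
    and vcomp_vid_left: "varr \<AA> v A C \<Longrightarrow> vid \<AA> C \<bullet> v = v"
    and cell_boundary:
      "cell \<AA> \<alpha> f v w g \<Longrightarrow>
        \<exists>A B C D. harr \<AA> f A B \<and> harr \<AA> g C D \<and> varr \<AA> v A C \<and> varr \<AA> w B D"
    and hcell_cell:
      "harr \<AA> f A B \<Longrightarrow> cell \<AA> (hcell \<AA> f) f (vid \<AA> A) (vid \<AA> B) f"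
    and vcell_cell:
      "varr \<AA> v A C \<Longrightarrow> cell \<AA> (vcell \<AA> v) (hid \<AA> A) v v (hid \<AA> C)"
    and hpaste_cell:
      "\<lbrakk>cell \<AA> \<alpha> f u v g; cell \<AA> \<beta> f' v w g'\<rbrakk> \<Longrightarrow> cell \<AA> (\<alpha> \<parallel> \<beta>) (f' \<cdot> f) u w (g' \<cdot> g)"
    and vpaste_cell:
      "\<lbrakk>cell \<AA> \<alpha> f v w g; cell \<AA> \<beta> g v' w' h\<rbrakk> \<Longrightarrow> cell \<AA> (\<alpha> \<div> \<beta>) f (v' \<bullet> v) (w' \<bullet> w) h"
    and hpaste_vcell_left: "cell \<AA> \<alpha> f v w g \<Longrightarrow> vcell \<AA> v \<parallel> \<alpha> = \<alpha>"
    and hpaste_vcell_right: "cell \<AA> \<alpha> f v w g \<Longrightarrow> \<alpha> \<parallel> vcell \<AA> w = \<alpha>"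
    and hpaste_assoc:
      "\<lbrakk>cell \<AA> \<alpha> f t u g; cell \<AA> \<beta> f' u v g'; cell \<AA> \<gamma> f'' v w g''\<rbrakk>
        \<Longrightarrow> (\<alpha> \<parallel> \<beta>) \<parallel> \<gamma> = \<alpha> \<parallel> (\<beta> \<parallel> \<gamma>)"
    and vpaste_hcell_top: "cell \<AA> \<alpha> f v w g \<Longrightarrow> hcell \<AA> f \<div> \<alpha> = \<alpha>"
    and vpaste_hcell_bot: "cell \<AA> \<alpha> f v w g \<Longrightarrow> \<alpha> \<div> hcell \<AA> g = \<alpha>"
    and interchange:
      "\<lbrakk>cell \<AA> \<alpha> f u v g; cell \<AA> \<beta> f' v w g'; cell \<AA> \<gamma> g u' v' h; cell \<AA> \<delta> g' v' w' h'\<rbrakk>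
        \<Longrightarrow> (\<alpha> \<parallel> \<beta>) \<div> (\<gamma> \<parallel> \<delta>) = (\<alpha> \<div> \<gamma>) \<parallel> (\<beta> \<div> \<delta>)"
    and hcell_hcomp:
      "\<lbrakk>harr \<AA> f A B; harr \<AA> g B C\<rbrakk> \<Longrightarrow> hcell \<AA> f \<parallel> hcell \<AA> g = hcell \<AA> (g \<cdot> f)"
    and vcell_vcomp:
      "\<lbrakk>varr \<AA> v A B; varr \<AA> w B C\<rbrakk> \<Longrightarrow> vcell \<AA> v \<div> vcell \<AA> w = vcell \<AA> (w \<bullet> v)"
    and hcell_hid: "A \<in> Obj \<AA> \<Longrightarrow> hcell \<AA> (hid \<AA> A) = vcell \<AA> (vid \<AA> A)"
    and vassoc_globular:
      "\<lbrakk>varr \<AA> u A B; varr \<AA> v B C; varr \<AA> w C D\<rbrakk>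
        \<Longrightarrow> globular \<AA> (vassoc \<AA> w v u) ((w \<bullet> v) \<bullet> u) (w \<bullet> (v \<bullet> u))"
    and vassoc_inv_globular:
      "\<lbrakk>varr \<AA> u A B; varr \<AA> v B C; varr \<AA> w C D\<rbrakk>
        \<Longrightarrow> globular \<AA> (vassoc_inv \<AA> w v u) (w \<bullet> (v \<bullet> u)) ((w \<bullet> v) \<bullet> u)"
    and vassoc_vassoc_inv:
      "\<lbrakk>varr \<AA> u A B; varr \<AA> v B C; varr \<AA> w C D\<rbrakk>
        \<Longrightarrow> vassoc \<AA> w v u \<parallel> vassoc_inv \<AA> w v u = vcell \<AA> ((w \<bullet> v) \<bullet> u)"
    and vassoc_inv_vassoc:
      "\<lbrakk>varr \<AA> u A B; varr \<AA> v B C; varr \<AA> w C D\<rbrakk>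
        \<Longrightarrow> vassoc_inv \<AA> w v u \<parallel> vassoc \<AA> w v u = vcell \<AA> (w \<bullet> (v \<bullet> u))"
    and vassoc_natural:
      "\<lbrakk>cell \<AA> \<alpha> f u u' g; cell \<AA> \<beta> g v v' h; cell \<AA> \<gamma> h w w' k\<rbrakk>
        \<Longrightarrow> vassoc \<AA> w v u \<parallel> ((\<alpha> \<div> \<beta>) \<div> \<gamma>) = (\<alpha> \<div> (\<beta> \<div> \<gamma>)) \<parallel> vassoc \<AA> w' v' u'"
  \<comment> \<open>the unitors in the triangle are identities because vertical identities are strict\<close>
    and pentagon:
      "\<lbrakk>varr \<AA> u A B; varr \<AA> v B C; varr \<AA> w C D; varr \<AA> x D E\<rbrakk>
        \<Longrightarrow> vassoc \<AA> (x \<bullet> w) v u \<parallel> vassoc \<AA> x w (v \<bullet> u)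
          = (vcell \<AA> u \<div> vassoc \<AA> x w v) \<parallel> vassoc \<AA> x (w \<bullet> v) u
              \<parallel> (vassoc \<AA> w v u \<div> vcell \<AA> x)"
    and triangle:
      "\<lbrakk>varr \<AA> u A B; varr \<AA> w B C\<rbrakk> \<Longrightarrow> vassoc \<AA> w (vid \<AA> B) u = vcell \<AA> (w \<bullet> u)"

text \<open>
  \<open>h\<close> is left adjoint to \<open>f\<close> in the 2-category of horizontal arrows: unit \<open>1 \<Rightarrow> f \<cdot> h\<close>, counit
  \<open>h \<cdot> f \<Rightarrow> 1\<close>.  There, 2-cells compose by vertical pasting and are whiskered by horizontal
  pasting with vertical identity cells.
\<close>

definition hor_left_adjoint :: "('o, 'h, 'v, 'c, 'm) double_cat_scheme \<Rightarrow> 'h \<Rightarrow> 'h \<Rightarrow> bool" where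
  "hor_left_adjoint \<AA> h f \<longleftrightarrow>
     (\<exists>A B \<eta> \<epsilon>. harr \<AA> f A B \<and> harr \<AA> h B A
        \<and> hor_2cell \<AA> \<eta> (hid \<AA> B) (f \<cdot>\<^bsub>\<AA>\<^esub> h)
        \<and> hor_2cell \<AA> \<epsilon> (h \<cdot>\<^bsub>\<AA>\<^esub> f) (hid \<AA> A)
        \<and> (\<eta> \<parallel>\<^bsub>\<AA>\<^esub> hcell \<AA> h) \<div>\<^bsub>\<AA>\<^esub> (hcell \<AA> h \<parallel>\<^bsub>\<AA>\<^esub> \<epsilon>) = hcell \<AA> h
        \<and> (hcell \<AA> f \<parallel>\<^bsub>\<AA>\<^esub> \<eta>) \<div>\<^bsub>\<AA>\<^esub> (\<epsilon> \<parallel>\<^bsub>\<AA>\<^esub> hcell \<AA> f) = hcell \<AA> f)"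

text \<open>
  \<open>x\<close> is left adjoint to \<open>v\<close> in the bicategory of vertical arrows: unit \<open>id \<Rightarrow> v \<bullet> x\<close>, counit
  \<open>x \<bullet> v \<Rightarrow> id\<close>.  There, 2-cells compose by horizontal pasting and are whiskered by vertical
  pasting with horizontal identity cells.
\<close>

definition ver_left_adjoint :: "('o, 'h, 'v, 'c, 'm) double_cat_scheme \<Rightarrow> 'v \<Rightarrow> 'v \<Rightarrow> bool" where
  "ver_left_adjoint \<AA> x v \<longleftrightarrow>
     (\<exists>A C \<eta> \<epsilon>. varr \<AA> v A C \<and> varr \<AA> x C A
        \<and> globular \<AA> \<eta> (vid \<AA> C) (v \<bullet>\<^bsub>\<AA>\<^esub> x)
        \<and> globular \<AA> \<epsilon> (x \<bullet>\<^bsub>\<AA>\<^esub> v) (vid \<AA> A)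
        \<and> (\<eta> \<div>\<^bsub>\<AA>\<^esub> vcell \<AA> x) \<parallel>\<^bsub>\<AA>\<^esub> vassoc_inv \<AA> x v x \<parallel>\<^bsub>\<AA>\<^esub> (vcell \<AA> x \<div>\<^bsub>\<AA>\<^esub> \<epsilon>)
            = vcell \<AA> x
        \<and> (vcell \<AA> v \<div>\<^bsub>\<AA>\<^esub> \<eta>) \<parallel>\<^bsub>\<AA>\<^esub> vassoc \<AA> v x v \<parallel>\<^bsub>\<AA>\<^esub> (\<epsilon> \<div>\<^bsub>\<AA>\<^esub> vcell \<AA> v)
            = vcell \<AA> v)"

definition is_companion ::
  "('o, 'h, 'v, 'c, 'm) double_cat_scheme \<Rightarrow> 'h \<Rightarrow> 'v \<Rightarrow> 'c \<Rightarrow> 'c \<Rightarrow> bool" where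
  "is_companion \<AA> f p \<psi> \<chi> \<longleftrightarrow>
     (\<exists>A B. harr \<AA> f A B \<and> varr \<AA> p A B
        \<and> cell \<AA> \<psi> (hid \<AA> A) (vid \<AA> A) p f
        \<and> cell \<AA> \<chi> f p (vid \<AA> B) (hid \<AA> B)
        \<and> \<psi> \<parallel>\<^bsub>\<AA>\<^esub> \<chi> = hcell \<AA> f
        \<and> \<psi> \<div>\<^bsub>\<AA>\<^esub> \<chi> = vcell \<AA> p)"

record ('o, 'h, 'v, 'c) companion_double_cat = "('o, 'h, 'v, 'c) double_cat" +
  companion :: "'h \<Rightarrow> 'v"
  psi :: "'h \<Rightarrow> 'c"
  chi :: "'h \<Rightarrow> 'c"

locale double_category_with_companions = double_category \<AA>
  for \<AA> :: "('o, 'h, 'v, 'c, 'm) companion_double_cat_scheme" (structure) +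
  assumes companion_is_companion:
      "f \<in> Hor \<AA> \<Longrightarrow> is_companion \<AA> f (companion \<AA> f) (psi \<AA> f) (chi \<AA> f)"
    and companion_hid: "A \<in> Obj \<AA> \<Longrightarrow> companion \<AA> (hid \<AA> A) = vid \<AA> A"

definition retrocell ::
  "('o, 'h, 'v, 'c, 'm) companion_double_cat_scheme \<Rightarrow> 'c \<Rightarrow> 'h \<Rightarrow> 'v \<Rightarrow> 'v \<Rightarrow> 'h \<Rightarrow> bool" where
  "retrocell \<AA> \<beta> f v w g \<longleftrightarrow>
     (\<exists>A B C D. harr \<AA> f A B \<and> harr \<AA> g C D \<and> varr \<AA> v A C \<and> varr \<AA> w B D)
     \<and> globular \<AA> \<beta> (w \<bullet>\<^bsub>\<AA>\<^esub> companion \<AA> f) (companion \<AA> g \<bullet>\<^bsub>\<AA>\<^esub> v)"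

end

theory Submission
  imports Defs "HOL-Library.Equipollence"
begin

text \<open>
  Both parts reduce to one principle: pasting a binding cell onto one edge of a cell moves a
  horizontal arrow from that edge to a vertical side, and pasting the other binding cell moves it
  back.  A companion \<open>f\<^sub>*\<close> of the top lets the top be absorbed into the right side, and a companion
  \<open>g\<^sub>*\<close> of the bottom lets the bottom be absorbed into the left side.  A conjoint, the mirror image
  of a companion, absorbs the top into the left side and the bottom into the right side
  (\<open>companion_top_eqpoll\<close>, \<open>companion_bottom_eqpoll\<close>, \<open>conjoint_top_eqpoll\<close>,
  \<open>conjoint_bottom_eqpoll\<close>).

  For vertical adjunctions, absorbing both horizontal edges by companions turns the cells into
  globular cells \<open>g\<^sub>* \<bullet> v \<Rightarrow> w \<bullet> f\<^sub>*\<close>.  Precomposition with \<open>v\<close> is left adjoint to precomposition with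
  \<open>x\<close>, because \<open>x\<close> is left adjoint to \<open>v\<close>, and postcomposition with \<open>y\<close> is left adjoint to
  postcomposition with \<open>w\<close> (\<open>precomposition_mate_eqpoll\<close>, \<open>postcomposition_mate_eqpoll\<close>).  Taking mates
  twice therefore gives
  \<open>g\<^sub>* \<Rightarrow> (w \<bullet> f\<^sub>*) \<bullet> x \<cong> w \<bullet> (f\<^sub>* \<bullet> x)\<close> and then \<open>y \<bullet> g\<^sub>* \<Rightarrow> f\<^sub>* \<bullet> x\<close>, which is a retrocell.

  For horizontal adjunctions, the companion of the left adjoint \<open>h\<close> is a conjoint of \<open>f\<close>, and likewise
  for \<open>k\<close> and \<open>g\<close> (\<open>conjoint_of_companion_of_left_adjoint\<close>).  Absorbing both horizontal edges by these
  conjoints turns the cells directly into globular cells \<open>v \<bullet> h\<^sub>* \<Rightarrow> k\<^sub>* \<bullet> w\<close>.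

  Vertical composition is only associative up to isomorphism.  Absorbing an edge regroups vertical
  composites only when one factor is an identity, and then the associator is an identity too;
  the mates are where nontrivial associators have to be moved past each other.
\<close>

lemma eqpollI_mutually_inverse:
  assumes "\<And>a. a \<in> X \<Longrightarrow> F a \<in> Y \<and> G (F a) = a"
    and "\<And>b. b \<in> Y \<Longrightarrow> G b \<in> X \<and> F (G b) = b"
  shows "X \<approx> Y"
  unfolding eqpoll_def
  by (rule exI[of _ F], rule bij_betw_byWitness[where f' = G]) (use assms in auto)

text \<open>
  A conjoint of \<open>f\<close> is a companion of \<open>f\<close> in the double category with horizontal direction reversed:
  \<open>\<zeta>\<close> absorbs \<open>f\<close> into a right side and \<open>\<xi>\<close> absorbs it into a left side.
\<close>

definition is_conjoint ::
  "('o, 'h, 'v, 'c, 'm) double_cat_scheme \<Rightarrow> 'h \<Rightarrow> 'v \<Rightarrow> 'c \<Rightarrow> 'c \<Rightarrow> bool" where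
  "is_conjoint \<AA> f q \<zeta> \<xi> \<longleftrightarrow>
     (\<exists>A B. harr \<AA> f A B \<and> varr \<AA> q B A
        \<and> cell \<AA> \<zeta> f (vid \<AA> A) q (hid \<AA> A)
        \<and> cell \<AA> \<xi> (hid \<AA> B) q (vid \<AA> B) f
        \<and> \<zeta> \<parallel>\<^bsub>\<AA>\<^esub> \<xi> = hcell \<AA> f
        \<and> \<xi> \<div>\<^bsub>\<AA>\<^esub> \<zeta> = vcell \<AA> q)"

context double_category
begin

section \<open>Boundaries and unit laws\<close>

text \<open>
  Boundaries are computed as values of the projections instead of being carried as parameters, so
  that composability of a pasting becomes an equation that rewriting can decide.
\<close>

lemma cell_iff [simp]:
  "cell \<AA> \<alpha> f v w g \<longleftrightarrow>
     \<alpha> \<in> Cells \<AA> \<and> ctop \<AA> \<alpha> = f \<and> cleft \<AA> \<alpha> = v \<and> cright \<AA> \<alpha> = w \<and> cbot \<AA> \<alpha> = g"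
  by (simp add: cell_def)

lemma harr_iff [simp]: "harr \<AA> f A B \<longleftrightarrow> f \<in> Hor \<AA> \<and> hdom \<AA> f = A \<and> hcod \<AA> f = B"
  by (simp add: harr_def)

lemma varr_iff [simp]: "varr \<AA> v A C \<longleftrightarrow> v \<in> Ver \<AA> \<and> vdom \<AA> v = A \<and> vcod \<AA> v = C"
  by (simp add: varr_def)

lemma globular_iff [simp]:
  "globular \<AA> \<alpha> v w \<longleftrightarrow> \<alpha> \<in> Cells \<AA> \<and> ctop \<AA> \<alpha> = hid \<AA> (vdom \<AA> v) \<and>
     cleft \<AA> \<alpha> = v \<and> cright \<AA> \<alpha> = w \<and> cbot \<AA> \<alpha> = hid \<AA> (vcod \<AA> v)"
  by (simp add: globular_def)

lemma Obj_simps [simp]: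
  "f \<in> Hor \<AA> \<Longrightarrow> hdom \<AA> f \<in> Obj \<AA>" "f \<in> Hor \<AA> \<Longrightarrow> hcod \<AA> f \<in> Obj \<AA>"
  "v \<in> Ver \<AA> \<Longrightarrow> vdom \<AA> v \<in> Obj \<AA>" "v \<in> Ver \<AA> \<Longrightarrow> vcod \<AA> v \<in> Obj \<AA>"
  using harr_obj[of f] varr_obj[of v] by auto

lemma hid_simps [simp]:
  assumes "A \<in> Obj \<AA>"
  shows "hid \<AA> A \<in> Hor \<AA>" "hdom \<AA> (hid \<AA> A) = A" "hcod \<AA> (hid \<AA> A) = A"
  using hid_arr[OF assms] by auto

lemma vid_simps [simp]:
  assumes "A \<in> Obj \<AA>"
  shows "vid \<AA> A \<in> Ver \<AA>" "vdom \<AA> (vid \<AA> A) = A" "vcod \<AA> (vid \<AA> A) = A"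
  using vid_arr[OF assms] by auto

lemma hcomp_simps [simp]:
  assumes "f \<in> Hor \<AA>" "g \<in> Hor \<AA>" "hcod \<AA> f = hdom \<AA> g"
  shows "g \<cdot> f \<in> Hor \<AA>" "hdom \<AA> (g \<cdot> f) = hdom \<AA> f" "hcod \<AA> (g \<cdot> f) = hcod \<AA> g"
  using hcomp_arr[of f _ _ g] assms by auto

lemma vcomp_simps [simp]:
  assumes "v \<in> Ver \<AA>" "w \<in> Ver \<AA>" "vcod \<AA> v = vdom \<AA> w"
  shows "w \<bullet> v \<in> Ver \<AA>" "vdom \<AA> (w \<bullet> v) = vdom \<AA> v" "vcod \<AA> (w \<bullet> v) = vcod \<AA> w"
  using vcomp_arr[of v _ _ w] assms by auto

lemma unit_simps [simp]:
  "f \<in> Hor \<AA> \<Longrightarrow> hdom \<AA> f = A \<Longrightarrow> f \<cdot> hid \<AA> A = f"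
  "f \<in> Hor \<AA> \<Longrightarrow> hcod \<AA> f = A \<Longrightarrow> hid \<AA> A \<cdot> f = f"
  "v \<in> Ver \<AA> \<Longrightarrow> vdom \<AA> v = A \<Longrightarrow> v \<bullet> vid \<AA> A = v"
  "v \<in> Ver \<AA> \<Longrightarrow> vcod \<AA> v = A \<Longrightarrow> vid \<AA> A \<bullet> v = v"
  using hcomp_hid_right[of f] hcomp_hid_left[of f] vcomp_vid_right[of v] vcomp_vid_left[of v]
  by auto

lemma hcomp_assoc_simp [simp]:
  "\<lbrakk>f \<in> Hor \<AA>; g \<in> Hor \<AA>; h \<in> Hor \<AA>; hcod \<AA> f = hdom \<AA> g; hcod \<AA> g = hdom \<AA> h\<rbrakk>
     \<Longrightarrow> (h \<cdot> g) \<cdot> f = h \<cdot> (g \<cdot> f)"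
  using hcomp_assoc[of f _ _ g _ h] by auto

lemma boundary_simps [simp]:
  assumes "\<alpha> \<in> Cells \<AA>"
  shows "ctop \<AA> \<alpha> \<in> Hor \<AA>" "cbot \<AA> \<alpha> \<in> Hor \<AA>" "cleft \<AA> \<alpha> \<in> Ver \<AA>" "cright \<AA> \<alpha> \<in> Ver \<AA>"
    "hdom \<AA> (ctop \<AA> \<alpha>) = vdom \<AA> (cleft \<AA> \<alpha>)" "hcod \<AA> (ctop \<AA> \<alpha>) = vdom \<AA> (cright \<AA> \<alpha>)"
    "hdom \<AA> (cbot \<AA> \<alpha>) = vcod \<AA> (cleft \<AA> \<alpha>)" "hcod \<AA> (cbot \<AA> \<alpha>) = vcod \<AA> (cright \<AA> \<alpha>)"
  using cell_boundary[of \<alpha>] assms by auto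

lemma hcell_simps [simp]:
  assumes "f \<in> Hor \<AA>"
  shows "hcell \<AA> f \<in> Cells \<AA>" "ctop \<AA> (hcell \<AA> f) = f" "cbot \<AA> (hcell \<AA> f) = f"
    "cleft \<AA> (hcell \<AA> f) = vid \<AA> (hdom \<AA> f)" "cright \<AA> (hcell \<AA> f) = vid \<AA> (hcod \<AA> f)"
  using hcell_cell[of f] assms by auto

lemma vcell_simps [simp]:
  assumes "v \<in> Ver \<AA>"
  shows "vcell \<AA> v \<in> Cells \<AA>" "cleft \<AA> (vcell \<AA> v) = v" "cright \<AA> (vcell \<AA> v) = v"
    "ctop \<AA> (vcell \<AA> v) = hid \<AA> (vdom \<AA> v)" "cbot \<AA> (vcell \<AA> v) = hid \<AA> (vcod \<AA> v)"
  using vcell_cell[of v] assms by auto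

lemma hpaste_simps [simp]:
  assumes "\<alpha> \<in> Cells \<AA>" "\<beta> \<in> Cells \<AA>" "cright \<AA> \<alpha> = cleft \<AA> \<beta>"
  shows "\<alpha> \<parallel> \<beta> \<in> Cells \<AA>" "cleft \<AA> (\<alpha> \<parallel> \<beta>) = cleft \<AA> \<alpha>" "cright \<AA> (\<alpha> \<parallel> \<beta>) = cright \<AA> \<beta>"
    "ctop \<AA> (\<alpha> \<parallel> \<beta>) = ctop \<AA> \<beta> \<cdot> ctop \<AA> \<alpha>" "cbot \<AA> (\<alpha> \<parallel> \<beta>) = cbot \<AA> \<beta> \<cdot> cbot \<AA> \<alpha>"
  using hpaste_cell[of \<alpha> _ _ _ _ \<beta>] assms by auto

lemma vpaste_simps [simp]:
  assumes "\<alpha> \<in> Cells \<AA>" "\<beta> \<in> Cells \<AA>" "cbot \<AA> \<alpha> = ctop \<AA> \<beta>"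
  shows "\<alpha> \<div> \<beta> \<in> Cells \<AA>" "ctop \<AA> (\<alpha> \<div> \<beta>) = ctop \<AA> \<alpha>" "cbot \<AA> (\<alpha> \<div> \<beta>) = cbot \<AA> \<beta>"
    "cleft \<AA> (\<alpha> \<div> \<beta>) = cleft \<AA> \<beta> \<bullet> cleft \<AA> \<alpha>" "cright \<AA> (\<alpha> \<div> \<beta>) = cright \<AA> \<beta> \<bullet> cright \<AA> \<alpha>"
  using vpaste_cell[of \<alpha> _ _ _ _ \<beta>] assms by auto

lemma paste_unit_simps [simp]:
  "\<alpha> \<in> Cells \<AA> \<Longrightarrow> cleft \<AA> \<alpha> = v \<Longrightarrow> vcell \<AA> v \<parallel> \<alpha> = \<alpha>"
  "\<alpha> \<in> Cells \<AA> \<Longrightarrow> cright \<AA> \<alpha> = v \<Longrightarrow> \<alpha> \<parallel> vcell \<AA> v = \<alpha>"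
  "\<alpha> \<in> Cells \<AA> \<Longrightarrow> ctop \<AA> \<alpha> = f \<Longrightarrow> hcell \<AA> f \<div> \<alpha> = \<alpha>"
  "\<alpha> \<in> Cells \<AA> \<Longrightarrow> cbot \<AA> \<alpha> = f \<Longrightarrow> \<alpha> \<div> hcell \<AA> f = \<alpha>"
  using hpaste_vcell_left hpaste_vcell_right vpaste_hcell_top vpaste_hcell_bot by auto

lemma vpaste_vid_simps [simp]:
  assumes "\<alpha> \<in> Cells \<AA>" "A \<in> Obj \<AA>"
  shows "ctop \<AA> \<alpha> = hid \<AA> A \<Longrightarrow> vcell \<AA> (vid \<AA> A) \<div> \<alpha> = \<alpha>"
    "cbot \<AA> \<alpha> = hid \<AA> A \<Longrightarrow> \<alpha> \<div> vcell \<AA> (vid \<AA> A) = \<alpha>"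
  using assms by (simp_all flip: hcell_hid)

declare hcell_hid [simp]

lemma cell_of_comp_simps [simp]:
  "\<lbrakk>f \<in> Hor \<AA>; g \<in> Hor \<AA>; hcod \<AA> f = hdom \<AA> g\<rbrakk> \<Longrightarrow> hcell \<AA> f \<parallel> hcell \<AA> g = hcell \<AA> (g \<cdot> f)"
  "\<lbrakk>v \<in> Ver \<AA>; w \<in> Ver \<AA>; vcod \<AA> v = vdom \<AA> w\<rbrakk> \<Longrightarrow> vcell \<AA> v \<div> vcell \<AA> w = vcell \<AA> (w \<bullet> v)"
  using hcell_hcomp[of f _ _ g] vcell_vcomp[of v _ _ w] by auto

lemma hpaste_assoc_simp:
  "\<lbrakk>\<alpha> \<in> Cells \<AA>; \<beta> \<in> Cells \<AA>; \<gamma> \<in> Cells \<AA>; cright \<AA> \<alpha> = cleft \<AA> \<beta>; cright \<AA> \<beta> = cleft \<AA> \<gamma>\<rbrakk>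
     \<Longrightarrow> (\<alpha> \<parallel> \<beta>) \<parallel> \<gamma> = \<alpha> \<parallel> (\<beta> \<parallel> \<gamma>)"
  using hpaste_assoc[of \<alpha> _ _ _ _ \<beta> _ _ _ \<gamma>] by auto

lemma interchange_cells:
  "\<lbrakk>\<alpha> \<in> Cells \<AA>; \<beta> \<in> Cells \<AA>; \<gamma> \<in> Cells \<AA>; \<delta> \<in> Cells \<AA>;
    cright \<AA> \<alpha> = cleft \<AA> \<beta>; cright \<AA> \<gamma> = cleft \<AA> \<delta>;
    cbot \<AA> \<alpha> = ctop \<AA> \<gamma>; cbot \<AA> \<beta> = ctop \<AA> \<delta>\<rbrakk>
     \<Longrightarrow> (\<alpha> \<parallel> \<beta>) \<div> (\<gamma> \<parallel> \<delta>) = (\<alpha> \<div> \<gamma>) \<parallel> (\<beta> \<div> \<delta>)"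
  using interchange[of \<alpha> _ _ _ _ \<beta> _ _ _ \<gamma> _ _ _ \<delta>] by auto

lemma vassoc_simps [simp]:
  assumes "u \<in> Ver \<AA>" "v \<in> Ver \<AA>" "w \<in> Ver \<AA>" "vcod \<AA> u = vdom \<AA> v" "vcod \<AA> v = vdom \<AA> w"
  shows "vassoc \<AA> w v u \<in> Cells \<AA>" "vassoc_inv \<AA> w v u \<in> Cells \<AA>"
    "cleft \<AA> (vassoc \<AA> w v u) = (w \<bullet> v) \<bullet> u" "cright \<AA> (vassoc \<AA> w v u) = w \<bullet> (v \<bullet> u)"
    "cleft \<AA> (vassoc_inv \<AA> w v u) = w \<bullet> (v \<bullet> u)" "cright \<AA> (vassoc_inv \<AA> w v u) = (w \<bullet> v) \<bullet> u"
    "ctop \<AA> (vassoc \<AA> w v u) = hid \<AA> (vdom \<AA> u)" "cbot \<AA> (vassoc \<AA> w v u) = hid \<AA> (vcod \<AA> w)"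
    "ctop \<AA> (vassoc_inv \<AA> w v u) = hid \<AA> (vdom \<AA> u)"
    "cbot \<AA> (vassoc_inv \<AA> w v u) = hid \<AA> (vcod \<AA> w)"
    "vassoc \<AA> w v u \<parallel> vassoc_inv \<AA> w v u = vcell \<AA> ((w \<bullet> v) \<bullet> u)"
    "vassoc_inv \<AA> w v u \<parallel> vassoc \<AA> w v u = vcell \<AA> (w \<bullet> (v \<bullet> u))"
  using vassoc_globular[of u _ _ v _ w] vassoc_inv_globular[of u _ _ v _ w]
    vassoc_vassoc_inv[of u _ _ v _ w] vassoc_inv_vassoc[of u _ _ v _ w] assms by auto

lemma vassoc_cancel [simp]:
  assumes "u \<in> Ver \<AA>" "v \<in> Ver \<AA>" "w \<in> Ver \<AA>" "vcod \<AA> u = vdom \<AA> v" "vcod \<AA> v = vdom \<AA> w"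
    "\<theta> \<in> Cells \<AA>"
  shows "cleft \<AA> \<theta> = (w \<bullet> v) \<bullet> u \<Longrightarrow> vassoc \<AA> w v u \<parallel> (vassoc_inv \<AA> w v u \<parallel> \<theta>) = \<theta>"
    "cleft \<AA> \<theta> = w \<bullet> (v \<bullet> u) \<Longrightarrow> vassoc_inv \<AA> w v u \<parallel> (vassoc \<AA> w v u \<parallel> \<theta>) = \<theta>"
  using assms by (simp_all flip: hpaste_assoc_simp)

section \<open>Coherence with strict vertical units\<close>

lemma vertically_composable:
  assumes "\<alpha> \<in> Cells \<AA>" "\<beta> \<in> Cells \<AA>" "cbot \<AA> \<alpha> = ctop \<AA> \<beta>"
  shows "vcod \<AA> (cleft \<AA> \<alpha>) = vdom \<AA> (cleft \<AA> \<beta>)" "vcod \<AA> (cright \<AA> \<alpha>) = vdom \<AA> (cright \<AA> \<beta>)"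
  using assms by (metis boundary_simps(5-8))+

lemma vassoc_naturality:
  "\<lbrakk>\<alpha> \<in> Cells \<AA>; \<beta> \<in> Cells \<AA>; \<gamma> \<in> Cells \<AA>; cbot \<AA> \<alpha> = ctop \<AA> \<beta>; cbot \<AA> \<beta> = ctop \<AA> \<gamma>\<rbrakk>
     \<Longrightarrow> vassoc \<AA> (cleft \<AA> \<gamma>) (cleft \<AA> \<beta>) (cleft \<AA> \<alpha>) \<parallel> ((\<alpha> \<div> \<beta>) \<div> \<gamma>) =
         (\<alpha> \<div> (\<beta> \<div> \<gamma>)) \<parallel> vassoc \<AA> (cright \<AA> \<gamma>) (cright \<AA> \<beta>) (cright \<AA> \<alpha>)"
  using vassoc_natural[of \<alpha> _ _ _ _ \<beta> _ _ _ \<gamma>] by auto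

lemma vassoc_inv_naturality:
  assumes "\<alpha> \<in> Cells \<AA>" "\<beta> \<in> Cells \<AA>" "\<gamma> \<in> Cells \<AA>" "cbot \<AA> \<alpha> = ctop \<AA> \<beta>" "cbot \<AA> \<beta> = ctop \<AA> \<gamma>"
  shows "vassoc_inv \<AA> (cleft \<AA> \<gamma>) (cleft \<AA> \<beta>) (cleft \<AA> \<alpha>) \<parallel> (\<alpha> \<div> (\<beta> \<div> \<gamma>)) =
         ((\<alpha> \<div> \<beta>) \<div> \<gamma>) \<parallel> vassoc_inv \<AA> (cright \<AA> \<gamma>) (cright \<AA> \<beta>) (cright \<AA> \<alpha>)"
proof -
  let ?a = "vassoc \<AA> (cleft \<AA> \<gamma>) (cleft \<AA> \<beta>) (cleft \<AA> \<alpha>)"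
  let ?b = "vassoc_inv \<AA> (cleft \<AA> \<gamma>) (cleft \<AA> \<beta>) (cleft \<AA> \<alpha>)"
  let ?a' = "vassoc \<AA> (cright \<AA> \<gamma>) (cright \<AA> \<beta>) (cright \<AA> \<alpha>)"
  let ?b' = "vassoc_inv \<AA> (cright \<AA> \<gamma>) (cright \<AA> \<beta>) (cright \<AA> \<alpha>)"
  note [simp] = assms vertically_composable[OF assms(1,2,4)] vertically_composable[OF assms(2,3,5)]
  have "?b \<parallel> (\<alpha> \<div> (\<beta> \<div> \<gamma>)) = ?b \<parallel> (((\<alpha> \<div> (\<beta> \<div> \<gamma>)) \<parallel> ?a') \<parallel> ?b')"
    by (simp add: hpaste_assoc_simp)
  also have "\<dots> = ?b \<parallel> ((?a \<parallel> ((\<alpha> \<div> \<beta>) \<div> \<gamma>)) \<parallel> ?b')"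
    by (simp only: vassoc_naturality[OF assms])
  also have "\<dots> = ((\<alpha> \<div> \<beta>) \<div> \<gamma>) \<parallel> ?b'"
    by (simp add: hpaste_assoc_simp)
  finally show ?thesis .
qed

lemma pentagon_cells:
  "\<lbrakk>u \<in> Ver \<AA>; v \<in> Ver \<AA>; w \<in> Ver \<AA>; x \<in> Ver \<AA>;
    vcod \<AA> u = vdom \<AA> v; vcod \<AA> v = vdom \<AA> w; vcod \<AA> w = vdom \<AA> x\<rbrakk>
     \<Longrightarrow> vassoc \<AA> (x \<bullet> w) v u \<parallel> vassoc \<AA> x w (v \<bullet> u) =
         (vcell \<AA> u \<div> vassoc \<AA> x w v) \<parallel> vassoc \<AA> x (w \<bullet> v) u \<parallel> (vassoc \<AA> w v u \<div> vcell \<AA> x)"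
  using pentagon[of u _ _ v _ w _ x] by auto

lemma whisker_simps:
  assumes "\<theta> \<in> Cells \<AA>" "\<phi> \<in> Cells \<AA>" "cright \<AA> \<theta> = cleft \<AA> \<phi>" "u \<in> Ver \<AA>"
  shows "\<lbrakk>ctop \<AA> \<theta> = hid \<AA> (vcod \<AA> u); ctop \<AA> \<phi> = hid \<AA> (vcod \<AA> u)\<rbrakk>
      \<Longrightarrow> vcell \<AA> u \<div> (\<theta> \<parallel> \<phi>) = (vcell \<AA> u \<div> \<theta>) \<parallel> (vcell \<AA> u \<div> \<phi>)"
    "\<lbrakk>cbot \<AA> \<theta> = hid \<AA> (vdom \<AA> u); cbot \<AA> \<phi> = hid \<AA> (vdom \<AA> u)\<rbrakk>
      \<Longrightarrow> (\<theta> \<parallel> \<phi>) \<div> vcell \<AA> u = (\<theta> \<div> vcell \<AA> u) \<parallel> (\<phi> \<div> vcell \<AA> u)"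
  using interchange_cells[of "vcell \<AA> u" "vcell \<AA> u" \<theta> \<phi>]
    interchange_cells[of \<theta> \<phi> "vcell \<AA> u" "vcell \<AA> u"] assms by simp_all

lemma vassoc_vid_middle [simp]:
  assumes "u \<in> Ver \<AA>" "w \<in> Ver \<AA>" "vcod \<AA> u = A" "vdom \<AA> w = A"
  shows "vassoc \<AA> w (vid \<AA> A) u = vcell \<AA> (w \<bullet> u)"
  using triangle[of u _ _ w] assms by auto

text \<open>
  The associator is invertible, so idempotence forces it to be an identity.  The side condition on
  boundaries is what makes the square of the associator a pasting at all.
\<close>

lemma idempotent_vassoc:
  assumes "u \<in> Ver \<AA>" "v \<in> Ver \<AA>" "w \<in> Ver \<AA>" "vcod \<AA> u = vdom \<AA> v" "vcod \<AA> v = vdom \<AA> w"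
    and "(w \<bullet> v) \<bullet> u = w \<bullet> (v \<bullet> u)"
    and idem: "vassoc \<AA> w v u = vassoc \<AA> w v u \<parallel> vassoc \<AA> w v u"
  shows "vassoc \<AA> w v u = vcell \<AA> (w \<bullet> (v \<bullet> u))"
proof -
  let ?a = "vassoc \<AA> w v u" and ?b = "vassoc_inv \<AA> w v u"
  have "?a = ?a \<parallel> (?a \<parallel> ?b)" using assms(1-6) by simp
  also have "\<dots> = (?a \<parallel> ?a) \<parallel> ?b" using assms(1-6) by (simp add: hpaste_assoc_simp)
  also have "\<dots> = ?a \<parallel> ?b" by (simp only: idem[symmetric])
  finally show ?thesis using assms(1-6) by simp
qed

text \<open>
  As in Kelly's redundancy argument for monoidal categories, the remaining unit laws follow from the
  triangle and the pentagon.  Since units are strict, a pentagon with two adjacent identities at one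
  end leaves only the associator in question, once on one side and twice on the other.
\<close>

lemma vassoc_vid_right [simp]:
  assumes "v \<in> Ver \<AA>" "w \<in> Ver \<AA>" "vdom \<AA> v = A" "vcod \<AA> v = vdom \<AA> w"
  shows "vassoc \<AA> w v (vid \<AA> A) = vcell \<AA> (w \<bullet> v)"
proof -
  have A: "A \<in> Obj \<AA>" using assms by auto
  have "vassoc \<AA> w v (vid \<AA> A) = vassoc \<AA> w v (vid \<AA> A) \<parallel> vassoc \<AA> w v (vid \<AA> A)"
    using pentagon_cells[of "vid \<AA> A" "vid \<AA> A" v w] assms A by simp
  then show ?thesis using idempotent_vassoc[of "vid \<AA> A" v w] assms A by simp
qed

lemma vassoc_vid_left [simp]:
  assumes "u \<in> Ver \<AA>" "v \<in> Ver \<AA>" "vcod \<AA> u = vdom \<AA> v" "vcod \<AA> v = A"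
  shows "vassoc \<AA> (vid \<AA> A) v u = vcell \<AA> (v \<bullet> u)"
proof -
  have A: "A \<in> Obj \<AA>" using assms by auto
  have "vassoc \<AA> (vid \<AA> A) v u = vassoc \<AA> (vid \<AA> A) v u \<parallel> vassoc \<AA> (vid \<AA> A) v u"
    using pentagon_cells[of u v "vid \<AA> A" "vid \<AA> A"] assms A by simp
  then show ?thesis using idempotent_vassoc[of u v "vid \<AA> A"] assms A by simp
qed

text \<open>
  Naturality of the associator compares the two ways to paste three cells; if each side of the
  stack contains a vertical identity, both associators in the comparison are identities.
\<close>

lemma vpaste_assoc_if_vid:
  assumes "\<alpha> \<in> Cells \<AA>" "\<beta> \<in> Cells \<AA>" "\<gamma> \<in> Cells \<AA>"
    and "cbot \<AA> \<alpha> = ctop \<AA> \<beta>" "cbot \<AA> \<beta> = ctop \<AA> \<gamma>"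
    and "cleft \<AA> \<alpha> \<in> vid \<AA> ` Obj \<AA> \<or> cleft \<AA> \<beta> \<in> vid \<AA> ` Obj \<AA> \<or> cleft \<AA> \<gamma> \<in> vid \<AA> ` Obj \<AA>"
    and "cright \<AA> \<alpha> \<in> vid \<AA> ` Obj \<AA> \<or> cright \<AA> \<beta> \<in> vid \<AA> ` Obj \<AA> \<or> cright \<AA> \<gamma> \<in> vid \<AA> ` Obj \<AA>"
  shows "(\<alpha> \<div> \<beta>) \<div> \<gamma> = \<alpha> \<div> (\<beta> \<div> \<gamma>)"
proof -
  have trivial: "vassoc \<AA> w v u = vcell \<AA> (w \<bullet> (v \<bullet> u)) \<and> (w \<bullet> v) \<bullet> u = w \<bullet> (v \<bullet> u)"
    if "u \<in> Ver \<AA>" "v \<in> Ver \<AA>" "w \<in> Ver \<AA>" "vcod \<AA> u = vdom \<AA> v" "vcod \<AA> v = vdom \<AA> w"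
      and "u \<in> vid \<AA> ` Obj \<AA> \<or> v \<in> vid \<AA> ` Obj \<AA> \<or> w \<in> vid \<AA> ` Obj \<AA>" for u v w
    using that by auto
  show ?thesis
    using vassoc_naturality[OF assms(1-5)] assms
      vertically_composable[OF assms(1,2,4)] vertically_composable[OF assms(2,3,5)]
      trivial[of "cleft \<AA> \<alpha>" "cleft \<AA> \<beta>" "cleft \<AA> \<gamma>"]
      trivial[of "cright \<AA> \<alpha>" "cright \<AA> \<beta>" "cright \<AA> \<gamma>"] 
    by simp
qed

section \<open>Absorbing horizontal edges into vertical sides\<close>

text \<open>
  Each of the four correspondences rests on the two binding equations: one round trip is an interchange
  followed by the horizontal equation, the other an interchange and a regrouping followed by the
  vertical one.
  In the second round trip, a vertical identity is first pasted beside the binding cell so that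
  the interchange law applies.
\<close>

lemma companion_top_eqpoll:
  assumes "is_companion \<AA> f p \<psi> \<chi>" and "f \<in> Hor \<AA>" "hdom \<AA> f = A"
    and "v \<in> Ver \<AA>" "vdom \<AA> v = A" "w \<in> Ver \<AA>" "vdom \<AA> w = hcod \<AA> f"
  shows "{\<alpha>. cell \<AA> \<alpha> f v w g} \<approx> {\<alpha>. cell \<AA> \<alpha> (hid \<AA> A) v (w \<bullet> p) g}"
proof (rule eqpollI_mutually_inverse[where F = "\<lambda>\<alpha>. \<psi> \<div> \<alpha>"
      and G = "\<lambda>\<beta>. \<beta> \<parallel> (\<chi> \<div> vcell \<AA> w)"])
  have comp: "p \<in> Ver \<AA>" "vdom \<AA> p = A" "vcod \<AA> p = hcod \<AA> f"
    "\<psi> \<in> Cells \<AA>" "ctop \<AA> \<psi> = hid \<AA> A" "cleft \<AA> \<psi> = vid \<AA> A" "cright \<AA> \<psi> = p" "cbot \<AA> \<psi> = f"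
    "\<chi> \<in> Cells \<AA>" "ctop \<AA> \<chi> = f" "cleft \<AA> \<chi> = p" "cright \<AA> \<chi> = vid \<AA> (hcod \<AA> f)"
    "cbot \<AA> \<chi> = hid \<AA> (hcod \<AA> f)" "\<psi> \<parallel> \<chi> = hcell \<AA> f" "\<psi> \<div> \<chi> = vcell \<AA> p"
    using assms by (auto simp: is_companion_def)
  have A: "A \<in> Obj \<AA>" using Obj_simps assms(2-4) by metis
  note [simp] = comp assms(2-)
  show "\<psi> \<div> \<alpha> \<in> {\<alpha>. cell \<AA> \<alpha> (hid \<AA> A) v (w \<bullet> p) g} \<and> (\<psi> \<div> \<alpha>) \<parallel> (\<chi> \<div> vcell \<AA> w) = \<alpha>"
    if "\<alpha> \<in> {\<alpha>. cell \<AA> \<alpha> f v w g}" for \<alpha>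
    using that interchange_cells[of \<psi> \<chi> \<alpha> "vcell \<AA> w"] by auto
  show "\<beta> \<parallel> (\<chi> \<div> vcell \<AA> w) \<in> {\<alpha>. cell \<AA> \<alpha> f v w g} \<and> \<psi> \<div> (\<beta> \<parallel> (\<chi> \<div> vcell \<AA> w)) = \<beta>"
    if "\<beta> \<in> {\<alpha>. cell \<AA> \<alpha> (hid \<AA> A) v (w \<bullet> p) g}" for \<beta>
  proof -
    have \<beta>: "\<beta> \<in> Cells \<AA>" "ctop \<AA> \<beta> = hid \<AA> A" "cleft \<AA> \<beta> = v" "cright \<AA> \<beta> = w \<bullet> p" "cbot \<AA> \<beta> = g"
      using that by auto
    have g: "g \<in> Hor \<AA>" "hcod \<AA> g = vcod \<AA> w" using boundary_simps[OF \<beta>(1)] \<beta> by auto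
    have "\<psi> \<div> (\<beta> \<parallel> (\<chi> \<div> vcell \<AA> w)) = (vcell \<AA> (vid \<AA> A) \<parallel> \<psi>) \<div> (\<beta> \<parallel> (\<chi> \<div> vcell \<AA> w))"
      using A by simp
    also have "\<dots> = (vcell \<AA> (vid \<AA> A) \<div> \<beta>) \<parallel> (\<psi> \<div> (\<chi> \<div> vcell \<AA> w))"
      by (rule interchange_cells) (use A \<beta> in simp_all)
    also have "\<psi> \<div> (\<chi> \<div> vcell \<AA> w) = (\<psi> \<div> \<chi>) \<div> vcell \<AA> w"
      by (rule vpaste_assoc_if_vid[symmetric]) (use A in auto)
    finally show ?thesis using \<beta> A g by simp
  qed
qed

lemma companion_bottom_eqpoll:
  assumes "is_companion \<AA> g p \<psi> \<chi>" and "g \<in> Hor \<AA>" "hcod \<AA> g = D"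
    and "v \<in> Ver \<AA>" "vcod \<AA> v = hdom \<AA> g" "w \<in> Ver \<AA>" "vcod \<AA> w = D"
  shows "{\<alpha>. cell \<AA> \<alpha> f v w g} \<approx> {\<alpha>. cell \<AA> \<alpha> f (p \<bullet> v) w (hid \<AA> D)}"
proof (rule eqpollI_mutually_inverse[where F = "\<lambda>\<alpha>. \<alpha> \<div> \<chi>"
      and G = "\<lambda>\<beta>. (vcell \<AA> v \<div> \<psi>) \<parallel> \<beta>"])
  have comp: "p \<in> Ver \<AA>" "vdom \<AA> p = hdom \<AA> g" "vcod \<AA> p = D"
    "\<psi> \<in> Cells \<AA>" "ctop \<AA> \<psi> = hid \<AA> (hdom \<AA> g)" "cleft \<AA> \<psi> = vid \<AA> (hdom \<AA> g)"
    "cright \<AA> \<psi> = p" "cbot \<AA> \<psi> = g"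
    "\<chi> \<in> Cells \<AA>" "ctop \<AA> \<chi> = g" "cleft \<AA> \<chi> = p" "cright \<AA> \<chi> = vid \<AA> D"
    "cbot \<AA> \<chi> = hid \<AA> D" "\<psi> \<parallel> \<chi> = hcell \<AA> g" "\<psi> \<div> \<chi> = vcell \<AA> p"
    using assms by (auto simp: is_companion_def)
  have D: "D \<in> Obj \<AA>" using Obj_simps assms(2-4) by metis
  note [simp] = comp assms(2-)
  show "\<alpha> \<div> \<chi> \<in> {\<alpha>. cell \<AA> \<alpha> f (p \<bullet> v) w (hid \<AA> D)} \<and> (vcell \<AA> v \<div> \<psi>) \<parallel> (\<alpha> \<div> \<chi>) = \<alpha>"
    if "\<alpha> \<in> {\<alpha>. cell \<AA> \<alpha> f v w g}" for \<alpha>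
    using that interchange_cells[of "vcell \<AA> v" \<alpha> \<psi> \<chi>] by auto
  show "(vcell \<AA> v \<div> \<psi>) \<parallel> \<beta> \<in> {\<alpha>. cell \<AA> \<alpha> f v w g} \<and> ((vcell \<AA> v \<div> \<psi>) \<parallel> \<beta>) \<div> \<chi> = \<beta>"
    if "\<beta> \<in> {\<alpha>. cell \<AA> \<alpha> f (p \<bullet> v) w (hid \<AA> D)}" for \<beta>
  proof -
    have \<beta>: "\<beta> \<in> Cells \<AA>" "ctop \<AA> \<beta> = f" "cleft \<AA> \<beta> = p \<bullet> v" "cright \<AA> \<beta> = w" "cbot \<AA> \<beta> = hid \<AA> D"
      using that by auto
    have f: "f \<in> Hor \<AA>" "hdom \<AA> f = vdom \<AA> v" using boundary_simps[OF \<beta>(1)] \<beta> by auto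
    have "((vcell \<AA> v \<div> \<psi>) \<parallel> \<beta>) \<div> \<chi> = ((vcell \<AA> v \<div> \<psi>) \<parallel> \<beta>) \<div> (\<chi> \<parallel> vcell \<AA> (vid \<AA> D))"
      using D by simp
    also have "\<dots> = ((vcell \<AA> v \<div> \<psi>) \<div> \<chi>) \<parallel> (\<beta> \<div> vcell \<AA> (vid \<AA> D))"
      by (rule interchange_cells) (use D \<beta> in simp_all)
    also have "(vcell \<AA> v \<div> \<psi>) \<div> \<chi> = vcell \<AA> v \<div> (\<psi> \<div> \<chi>)"
      by (rule vpaste_assoc_if_vid) (use D in auto)
    finally show ?thesis using \<beta> D f by simp
  qed
qed

lemma conjoint_top_eqpoll:
  assumes "is_conjoint \<AA> f q \<zeta> \<xi>" and "f \<in> Hor \<AA>" "hcod \<AA> f = B"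
    and "v \<in> Ver \<AA>" "vdom \<AA> v = hdom \<AA> f" "w \<in> Ver \<AA>" "vdom \<AA> w = B"
  shows "{\<alpha>. cell \<AA> \<alpha> f v w g} \<approx> {\<alpha>. cell \<AA> \<alpha> (hid \<AA> B) (v \<bullet> q) w g}"
proof (rule eqpollI_mutually_inverse[where F = "\<lambda>\<alpha>. \<xi> \<div> \<alpha>"
      and G = "\<lambda>\<beta>. (\<zeta> \<div> vcell \<AA> v) \<parallel> \<beta>"])
  have conj: "q \<in> Ver \<AA>" "vdom \<AA> q = B" "vcod \<AA> q = hdom \<AA> f"
    "\<zeta> \<in> Cells \<AA>" "ctop \<AA> \<zeta> = f" "cleft \<AA> \<zeta> = vid \<AA> (hdom \<AA> f)" "cright \<AA> \<zeta> = q"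
    "cbot \<AA> \<zeta> = hid \<AA> (hdom \<AA> f)"
    "\<xi> \<in> Cells \<AA>" "ctop \<AA> \<xi> = hid \<AA> B" "cleft \<AA> \<xi> = q" "cright \<AA> \<xi> = vid \<AA> B" "cbot \<AA> \<xi> = f"
    "\<zeta> \<parallel> \<xi> = hcell \<AA> f" "\<xi> \<div> \<zeta> = vcell \<AA> q"
    using assms by (auto simp: is_conjoint_def)
  have B: "B \<in> Obj \<AA>" using Obj_simps assms(2-4) by metis
  note [simp] = conj assms(2-)
  show "\<xi> \<div> \<alpha> \<in> {\<alpha>. cell \<AA> \<alpha> (hid \<AA> B) (v \<bullet> q) w g} \<and> (\<zeta> \<div> vcell \<AA> v) \<parallel> (\<xi> \<div> \<alpha>) = \<alpha>"
    if "\<alpha> \<in> {\<alpha>. cell \<AA> \<alpha> f v w g}" for \<alpha>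
    using that interchange_cells[of \<zeta> \<xi> "vcell \<AA> v" \<alpha>] by auto
  show "(\<zeta> \<div> vcell \<AA> v) \<parallel> \<beta> \<in> {\<alpha>. cell \<AA> \<alpha> f v w g} \<and> \<xi> \<div> ((\<zeta> \<div> vcell \<AA> v) \<parallel> \<beta>) = \<beta>"
    if "\<beta> \<in> {\<alpha>. cell \<AA> \<alpha> (hid \<AA> B) (v \<bullet> q) w g}" for \<beta>
  proof -
    have \<beta>: "\<beta> \<in> Cells \<AA>" "ctop \<AA> \<beta> = hid \<AA> B" "cleft \<AA> \<beta> = v \<bullet> q" "cright \<AA> \<beta> = w" "cbot \<AA> \<beta> = g"
      using that by auto
    have g: "g \<in> Hor \<AA>" "hdom \<AA> g = vcod \<AA> v" using boundary_simps[OF \<beta>(1)] \<beta> by auto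
    have "\<xi> \<div> ((\<zeta> \<div> vcell \<AA> v) \<parallel> \<beta>) = (\<xi> \<parallel> vcell \<AA> (vid \<AA> B)) \<div> ((\<zeta> \<div> vcell \<AA> v) \<parallel> \<beta>)"
      using B by simp
    also have "\<dots> = (\<xi> \<div> (\<zeta> \<div> vcell \<AA> v)) \<parallel> (vcell \<AA> (vid \<AA> B) \<div> \<beta>)"
      by (rule interchange_cells) (use B \<beta> in simp_all)
    also have "\<xi> \<div> (\<zeta> \<div> vcell \<AA> v) = (\<xi> \<div> \<zeta>) \<div> vcell \<AA> v"
      by (rule vpaste_assoc_if_vid[symmetric]) (use B in auto)
    finally show ?thesis using \<beta> B g by simp
  qed
qed

lemma conjoint_bottom_eqpoll:
  assumes "is_conjoint \<AA> g q \<zeta> \<xi>" and "g \<in> Hor \<AA>" "hdom \<AA> g = C"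
    and "v \<in> Ver \<AA>" "vcod \<AA> v = C" "w \<in> Ver \<AA>" "vcod \<AA> w = hcod \<AA> g"
  shows "{\<alpha>. cell \<AA> \<alpha> f v w g} \<approx> {\<alpha>. cell \<AA> \<alpha> f v (q \<bullet> w) (hid \<AA> C)}"
proof (rule eqpollI_mutually_inverse[where F = "\<lambda>\<alpha>. \<alpha> \<div> \<zeta>"
      and G = "\<lambda>\<beta>. \<beta> \<parallel> (vcell \<AA> w \<div> \<xi>)"])
  have conj: "q \<in> Ver \<AA>" "vdom \<AA> q = hcod \<AA> g" "vcod \<AA> q = C"
    "\<zeta> \<in> Cells \<AA>" "ctop \<AA> \<zeta> = g" "cleft \<AA> \<zeta> = vid \<AA> C" "cright \<AA> \<zeta> = q" "cbot \<AA> \<zeta> = hid \<AA> C"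
    "\<xi> \<in> Cells \<AA>" "ctop \<AA> \<xi> = hid \<AA> (hcod \<AA> g)" "cleft \<AA> \<xi> = q" "cright \<AA> \<xi> = vid \<AA> (hcod \<AA> g)"
    "cbot \<AA> \<xi> = g" "\<zeta> \<parallel> \<xi> = hcell \<AA> g" "\<xi> \<div> \<zeta> = vcell \<AA> q"
    using assms by (auto simp: is_conjoint_def)
  have C: "C \<in> Obj \<AA>" using Obj_simps assms(2-4) by metis
  note [simp] = conj assms(2-)
  show "\<alpha> \<div> \<zeta> \<in> {\<alpha>. cell \<AA> \<alpha> f v (q \<bullet> w) (hid \<AA> C)} \<and> (\<alpha> \<div> \<zeta>) \<parallel> (vcell \<AA> w \<div> \<xi>) = \<alpha>"
    if "\<alpha> \<in> {\<alpha>. cell \<AA> \<alpha> f v w g}" for \<alpha>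
    using that interchange_cells[of \<alpha> "vcell \<AA> w" \<zeta> \<xi>] by auto
  show "\<beta> \<parallel> (vcell \<AA> w \<div> \<xi>) \<in> {\<alpha>. cell \<AA> \<alpha> f v w g} \<and> (\<beta> \<parallel> (vcell \<AA> w \<div> \<xi>)) \<div> \<zeta> = \<beta>"
    if "\<beta> \<in> {\<alpha>. cell \<AA> \<alpha> f v (q \<bullet> w) (hid \<AA> C)}" for \<beta>
  proof -
    have \<beta>: "\<beta> \<in> Cells \<AA>" "ctop \<AA> \<beta> = f" "cleft \<AA> \<beta> = v" "cright \<AA> \<beta> = q \<bullet> w" "cbot \<AA> \<beta> = hid \<AA> C"
      using that by auto
    have f: "f \<in> Hor \<AA>" "hcod \<AA> f = vdom \<AA> w" using boundary_simps[OF \<beta>(1)] \<beta> by auto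
    have "(\<beta> \<parallel> (vcell \<AA> w \<div> \<xi>)) \<div> \<zeta> = (\<beta> \<parallel> (vcell \<AA> w \<div> \<xi>)) \<div> (vcell \<AA> (vid \<AA> C) \<parallel> \<zeta>)"
      using C by simp
    also have "\<dots> = (\<beta> \<div> vcell \<AA> (vid \<AA> C)) \<parallel> ((vcell \<AA> w \<div> \<xi>) \<div> \<zeta>)"
      by (rule interchange_cells) (use C \<beta> in simp_all)
    also have "(vcell \<AA> w \<div> \<xi>) \<div> \<zeta> = vcell \<AA> w \<div> (\<xi> \<div> \<zeta>)"
      by (rule vpaste_assoc_if_vid) (use C in auto)
    finally show ?thesis using \<beta> C f by simp
  qed
qed

section \<open>The companion of a left adjoint is a conjoint of the right adjoint\<close>

text \<open>
  Whiskering the binding cells of \<open>h\<close> with \<open>f\<close> and capping them with the counit and the unit of the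
  adjunction produces cells with the boundaries required for \<open>f\<close>.  The horizontal binding
  equation reduces to the triangle identity of \<open>f\<close>, the vertical one to that of \<open>h\<close>.
\<close>

lemma conjoint_of_companion_of_left_adjoint:
  assumes comp: "is_companion \<AA> h p \<psi> \<chi>" and adj: "hor_left_adjoint \<AA> h f"
  shows "\<exists>\<zeta> \<xi>. is_conjoint \<AA> f p \<zeta> \<xi>"
proof -
  obtain A B \<eta> \<epsilon> where AB: "f \<in> Hor \<AA>" "hdom \<AA> f = A" "hcod \<AA> f = B"
      "h \<in> Hor \<AA>" "hdom \<AA> h = B" "hcod \<AA> h = A"
    and \<eta>: "\<eta> \<in> Cells \<AA>" "ctop \<AA> \<eta> = hid \<AA> B" "cleft \<AA> \<eta> = vid \<AA> B" "cright \<AA> \<eta> = vid \<AA> B"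
      "cbot \<AA> \<eta> = f \<cdot> h"
    and \<epsilon>: "\<epsilon> \<in> Cells \<AA>" "ctop \<AA> \<epsilon> = h \<cdot> f" "cleft \<AA> \<epsilon> = vid \<AA> A" "cright \<AA> \<epsilon> = vid \<AA> A"
      "cbot \<AA> \<epsilon> = hid \<AA> A"
    and tri_h: "(\<eta> \<parallel> hcell \<AA> h) \<div> (hcell \<AA> h \<parallel> \<epsilon>) = hcell \<AA> h"
    and tri_f: "(hcell \<AA> f \<parallel> \<eta>) \<div> (\<epsilon> \<parallel> hcell \<AA> f) = hcell \<AA> f"
    using adj by (auto simp: hor_left_adjoint_def hor_2cell_def)
  have comp: "p \<in> Ver \<AA>" "vdom \<AA> p = B" "vcod \<AA> p = A"
    "\<psi> \<in> Cells \<AA>" "ctop \<AA> \<psi> = hid \<AA> B" "cleft \<AA> \<psi> = vid \<AA> B" "cright \<AA> \<psi> = p" "cbot \<AA> \<psi> = h"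
    "\<chi> \<in> Cells \<AA>" "ctop \<AA> \<chi> = h" "cleft \<AA> \<chi> = p" "cright \<AA> \<chi> = vid \<AA> A" "cbot \<AA> \<chi> = hid \<AA> A"
    "\<psi> \<parallel> \<chi> = hcell \<AA> h" "\<psi> \<div> \<chi> = vcell \<AA> p"
    using comp AB by (auto simp: is_companion_def)
  have obj: "A \<in> Obj \<AA>" "B \<in> Obj \<AA>" using AB Obj_simps by metis+
  note [simp] = AB obj \<eta> \<epsilon> comp
  define \<zeta> where "\<zeta> = (hcell \<AA> f \<parallel> \<psi>) \<div> \<epsilon>"
  define \<xi> where "\<xi> = \<eta> \<div> (\<chi> \<parallel> hcell \<AA> f)"
  have "\<zeta> \<parallel> \<xi> = (hcell \<AA> f \<div> \<zeta>) \<parallel> (\<eta> \<div> ((\<chi> \<parallel> hcell \<AA> f) \<div> hcell \<AA> f))"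
    by (simp add: \<zeta>_def \<xi>_def)
  also have "\<dots> = (hcell \<AA> f \<parallel> \<eta>) \<div> (\<zeta> \<parallel> ((\<chi> \<parallel> hcell \<AA> f) \<div> hcell \<AA> f))"
    by (rule interchange_cells[symmetric]) (simp_all add: \<zeta>_def)
  also have "\<zeta> \<parallel> ((\<chi> \<parallel> hcell \<AA> f) \<div> hcell \<AA> f) =
      ((hcell \<AA> f \<parallel> \<psi>) \<parallel> (\<chi> \<parallel> hcell \<AA> f)) \<div> (\<epsilon> \<parallel> hcell \<AA> f)"
    unfolding \<zeta>_def by (rule interchange_cells[symmetric]) simp_all
  \<comment> \<open>The binding equation \<open>\<psi> \<parallel> \<chi> = hcell h\<close> must not fire here: it would hide the regrouping.\<close>
  also have "(hcell \<AA> f \<parallel> \<psi>) \<parallel> (\<chi> \<parallel> hcell \<AA> f) = hcell \<AA> f \<parallel> ((\<psi> \<parallel> \<chi>) \<parallel> hcell \<AA> f)"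
    by (simp add: hpaste_assoc_simp del: comp(14))
  also have "\<dots> \<div> (\<epsilon> \<parallel> hcell \<AA> f) = \<epsilon> \<parallel> hcell \<AA> f"
    by simp
  finally have horizontal: "\<zeta> \<parallel> \<xi> = hcell \<AA> f"
    by (simp add: tri_f)
  \<comment> \<open>Both \<open>\<xi> \<div> \<zeta>\<close> and \<open>(\<eta> \<parallel> \<psi>) \<div> (\<chi> \<parallel> \<epsilon>)\<close> are \<open>\<eta>\<close> above \<open>\<chi> \<parallel> f \<parallel> \<psi>\<close> above \<open>\<epsilon>\<close>:
    \<open>\<psi>\<close> and \<open>\<chi>\<close> occupy different columns, so either may be placed above the other.\<close>
  have \<eta>_\<psi>: "\<eta> \<parallel> \<psi> = \<eta> \<div> (hcell \<AA> (f \<cdot> h) \<parallel> \<psi>)"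
    using interchange_cells[of \<eta> "vcell \<AA> (vid \<AA> B)" "hcell \<AA> (f \<cdot> h)" \<psi>] by simp
  have \<chi>_\<epsilon>: "\<chi> \<parallel> \<epsilon> = (\<chi> \<parallel> hcell \<AA> (h \<cdot> f)) \<div> \<epsilon>"
    using interchange_cells[of \<chi> "hcell \<AA> (h \<cdot> f)" "vcell \<AA> (vid \<AA> A)" \<epsilon>] by simp
  have "(hcell \<AA> (f \<cdot> h) \<parallel> \<psi>) \<div> (\<chi> \<parallel> hcell \<AA> (h \<cdot> f)) =
      (hcell \<AA> h \<parallel> (hcell \<AA> f \<parallel> \<psi>)) \<div> (\<chi> \<parallel> (hcell \<AA> f \<parallel> hcell \<AA> h))"
    by (simp flip: hpaste_assoc_simp)
  also have "\<dots> = (hcell \<AA> h \<div> \<chi>) \<parallel> ((hcell \<AA> f \<parallel> \<psi>) \<div> (hcell \<AA> f \<parallel> hcell \<AA> h))"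
    by (rule interchange_cells) simp_all
  also have "(hcell \<AA> f \<parallel> \<psi>) \<div> (hcell \<AA> f \<parallel> hcell \<AA> h) = hcell \<AA> f \<parallel> \<psi>"
    by (subst interchange_cells) simp_all
  finally have middle: "(hcell \<AA> (f \<cdot> h) \<parallel> \<psi>) \<div> (\<chi> \<parallel> hcell \<AA> (h \<cdot> f)) = \<chi> \<parallel> (hcell \<AA> f \<parallel> \<psi>)"
    by simp
  have "(\<chi> \<parallel> hcell \<AA> f) \<div> (hcell \<AA> f \<parallel> \<psi>) =
      (\<chi> \<parallel> hcell \<AA> f) \<div> (vcell \<AA> (vid \<AA> A) \<parallel> (hcell \<AA> f \<parallel> \<psi>))"
    by simp
  also have "\<dots> = (\<chi> \<div> vcell \<AA> (vid \<AA> A)) \<parallel> (hcell \<AA> f \<div> (hcell \<AA> f \<parallel> \<psi>))"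
    by (rule interchange_cells) simp_all
  finally have middle': "(\<chi> \<parallel> hcell \<AA> f) \<div> (hcell \<AA> f \<parallel> \<psi>) = \<chi> \<parallel> (hcell \<AA> f \<parallel> \<psi>)"
    by simp
  have "\<xi> \<div> \<zeta> = \<eta> \<div> (((\<chi> \<parallel> hcell \<AA> f) \<div> (hcell \<AA> f \<parallel> \<psi>)) \<div> \<epsilon>)"
    unfolding \<xi>_def \<zeta>_def by (simp add: vpaste_assoc_if_vid)
  also have "\<dots> = \<eta> \<div> (((hcell \<AA> (f \<cdot> h) \<parallel> \<psi>) \<div> (\<chi> \<parallel> hcell \<AA> (h \<cdot> f))) \<div> \<epsilon>)"
    by (simp only: middle middle')
  also have "\<dots> = (\<eta> \<parallel> \<psi>) \<div> (\<chi> \<parallel> \<epsilon>)"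
    unfolding \<eta>_\<psi> \<chi>_\<epsilon> by (simp add: vpaste_assoc_if_vid)
  \<comment> \<open>Sliding \<open>\<psi>\<close> to the very top and \<open>\<chi>\<close> to the very bottom isolates the triangle identity of \<open>h\<close>.\<close>
  also have "\<eta> \<parallel> \<psi> = \<psi> \<div> (\<eta> \<parallel> hcell \<AA> h)"
    using interchange_cells[of "vcell \<AA> (vid \<AA> B)" \<psi> \<eta> "hcell \<AA> h"] by simp
  also have "\<chi> \<parallel> \<epsilon> = (hcell \<AA> h \<parallel> \<epsilon>) \<div> \<chi>"
    using interchange_cells[of "hcell \<AA> h" \<epsilon> \<chi> "vcell \<AA> (vid \<AA> A)"] by simp
  also have "(\<psi> \<div> (\<eta> \<parallel> hcell \<AA> h)) \<div> ((hcell \<AA> h \<parallel> \<epsilon>) \<div> \<chi>) =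
      \<psi> \<div> (((\<eta> \<parallel> hcell \<AA> h) \<div> (hcell \<AA> h \<parallel> \<epsilon>)) \<div> \<chi>)"
    by (simp add: vpaste_assoc_if_vid)
  also have "\<dots> = vcell \<AA> p"
    by (simp add: tri_h)
  finally have vertical: "\<xi> \<div> \<zeta> = vcell \<AA> p" .
  have "is_conjoint \<AA> f p \<zeta> \<xi>"
    using horizontal vertical by (auto simp: is_conjoint_def \<zeta>_def \<xi>_def)
  then show ?thesis by blast
qed

section \<open>Mates along vertical adjunctions\<close>

text \<open>
  An adjunction between vertical arrows induces one between hom-categories: whiskering its unit and
  counit gives natural transformations \<open>unit p : p \<Rightarrow> (p \<bullet> v) \<bullet> x\<close> and
  \<open>counit r : (r \<bullet> x) \<bullet> v \<Rightarrow> r\<close>.  The two composites of the transposition maps are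
  identities because of naturality and of the triangle identities for these two; the latter come
  from those of the given adjunction by moving the associators together and applying the pentagon.
\<close>

lemma precomposition_mate_eqpoll:
  assumes "ver_left_adjoint \<AA> x v" and "v \<in> Ver \<AA>" "x \<in> Ver \<AA>" "p \<in> Ver \<AA>" "r \<in> Ver \<AA>"
    and "vdom \<AA> p = vcod \<AA> v" "vdom \<AA> r = vdom \<AA> v" "vcod \<AA> r = vcod \<AA> p"
  shows "{\<theta>. globular \<AA> \<theta> (p \<bullet> v) r} \<approx> {\<phi>. globular \<AA> \<phi> p (r \<bullet> x)}"
proof -
  obtain \<eta> \<epsilon> where x: "vdom \<AA> x = vcod \<AA> v" "vcod \<AA> x = vdom \<AA> v"
    and \<eta>: "\<eta> \<in> Cells \<AA>" "ctop \<AA> \<eta> = hid \<AA> (vcod \<AA> v)" "cleft \<AA> \<eta> = vid \<AA> (vcod \<AA> v)"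
      "cright \<AA> \<eta> = v \<bullet> x" "cbot \<AA> \<eta> = hid \<AA> (vcod \<AA> v)"
    and \<epsilon>: "\<epsilon> \<in> Cells \<AA>" "ctop \<AA> \<epsilon> = hid \<AA> (vdom \<AA> v)" "cleft \<AA> \<epsilon> = x \<bullet> v"
      "cright \<AA> \<epsilon> = vid \<AA> (vdom \<AA> v)" "cbot \<AA> \<epsilon> = hid \<AA> (vdom \<AA> v)"
    and tri_x: "(\<eta> \<div> vcell \<AA> x) \<parallel> vassoc_inv \<AA> x v x \<parallel> (vcell \<AA> x \<div> \<epsilon>) = vcell \<AA> x"
    and tri_v: "(vcell \<AA> v \<div> \<eta>) \<parallel> vassoc \<AA> v x v \<parallel> (\<epsilon> \<div> vcell \<AA> v) = vcell \<AA> v"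
    using assms by (auto simp: ver_left_adjoint_def)
  note [simp] = x \<eta> \<epsilon> assms(2-)
  define unit where "unit p = (\<eta> \<div> vcell \<AA> p) \<parallel> vassoc_inv \<AA> p v x" for p
  define counit where "counit r = vassoc \<AA> r x v \<parallel> (\<epsilon> \<div> vcell \<AA> r)" for r
  have triangle_p: "(vcell \<AA> v \<div> unit p) \<parallel> counit (p \<bullet> v) = vcell \<AA> (p \<bullet> v)"
  proof -
    \<comment> \<open>Rewrite the whiskerings so that \<open>\<eta>\<close>, \<open>\<epsilon>\<close> and the associators end in one strip \<open>\<dots> \<div> vcell p\<close>.\<close>
    have split: "\<epsilon> \<div> vcell \<AA> (p \<bullet> v) = vassoc \<AA> p v (x \<bullet> v) \<parallel> ((\<epsilon> \<div> vcell \<AA> v) \<div> vcell \<AA> p)"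
      using vassoc_naturality[of \<epsilon> "vcell \<AA> v" "vcell \<AA> p"] by simp
    have slide: "(vcell \<AA> v \<div> (\<eta> \<div> vcell \<AA> p)) \<parallel> vassoc \<AA> p (v \<bullet> x) v =
        (vcell \<AA> v \<div> \<eta>) \<div> vcell \<AA> p"
      using vassoc_naturality[of "vcell \<AA> v" \<eta> "vcell \<AA> p"] by simp
    have cancel: "(vcell \<AA> v \<div> vassoc_inv \<AA> p v x) \<parallel> (vcell \<AA> v \<div> vassoc \<AA> p v x) =
        vcell \<AA> ((p \<bullet> (v \<bullet> x)) \<bullet> v)"
      by (simp flip: whisker_simps)
    have "(vcell \<AA> v \<div> unit p) \<parallel> counit (p \<bullet> v) =
        (vcell \<AA> v \<div> (\<eta> \<div> vcell \<AA> p)) \<parallel> (vcell \<AA> v \<div> vassoc_inv \<AA> p v x) \<parallel>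
        (vassoc \<AA> (p \<bullet> v) x v \<parallel> vassoc \<AA> p v (x \<bullet> v)) \<parallel> ((\<epsilon> \<div> vcell \<AA> v) \<div> vcell \<AA> p)"
      by (simp add: unit_def counit_def whisker_simps split hpaste_assoc_simp)
    also have "\<dots> = (vcell \<AA> v \<div> (\<eta> \<div> vcell \<AA> p)) \<parallel>
        ((vcell \<AA> v \<div> vassoc_inv \<AA> p v x) \<parallel> (vcell \<AA> v \<div> vassoc \<AA> p v x)) \<parallel>
        vassoc \<AA> p (v \<bullet> x) v \<parallel> (vassoc \<AA> v x v \<div> vcell \<AA> p) \<parallel> ((\<epsilon> \<div> vcell \<AA> v) \<div> vcell \<AA> p)"
      by (simp add: pentagon_cells hpaste_assoc_simp)
    also have "\<dots> = ((vcell \<AA> v \<div> \<eta>) \<div> vcell \<AA> p) \<parallel> (vassoc \<AA> v x v \<div> vcell \<AA> p) \<parallel>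
        ((\<epsilon> \<div> vcell \<AA> v) \<div> vcell \<AA> p)"
      unfolding cancel by (simp add: slide)
    also have "\<dots> = ((vcell \<AA> v \<div> \<eta>) \<parallel> vassoc \<AA> v x v \<parallel> (\<epsilon> \<div> vcell \<AA> v)) \<div> vcell \<AA> p"
      by (simp add: whisker_simps)
    finally show ?thesis by (simp add: tri_v)
  qed
  have triangle_r: "unit (r \<bullet> x) \<parallel> (vcell \<AA> x \<div> counit r) = vcell \<AA> (r \<bullet> x)"
  proof -
    have split: "\<eta> \<div> vcell \<AA> (r \<bullet> x) = ((\<eta> \<div> vcell \<AA> x) \<div> vcell \<AA> r) \<parallel> vassoc_inv \<AA> r x (v \<bullet> x)"
      using vassoc_naturality[of \<eta> "vcell \<AA> x" "vcell \<AA> r"] by (simp add: hpaste_assoc_simp)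
    have slide: "vcell \<AA> x \<div> (\<epsilon> \<div> vcell \<AA> r) =
        vassoc \<AA> r (x \<bullet> v) x \<parallel> ((vcell \<AA> x \<div> \<epsilon>) \<div> vcell \<AA> r)"
      using vassoc_naturality[of "vcell \<AA> x" \<epsilon> "vcell \<AA> r"] by simp
    have middle: "vassoc_inv \<AA> r x (v \<bullet> x) \<parallel> vassoc_inv \<AA> (r \<bullet> x) v x \<parallel> (vcell \<AA> x \<div> vassoc \<AA> r x v) \<parallel>
        vassoc \<AA> r (x \<bullet> v) x = vassoc_inv \<AA> x v x \<div> vcell \<AA> r"
    proof -
      have "(vassoc \<AA> x v x \<div> vcell \<AA> r) \<parallel> (vassoc_inv \<AA> x v x \<div> vcell \<AA> r) =
          vcell \<AA> (r \<bullet> ((x \<bullet> v) \<bullet> x))"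
        by (simp flip: whisker_simps)
      then have "(vcell \<AA> x \<div> vassoc \<AA> r x v) \<parallel> vassoc \<AA> r (x \<bullet> v) x =
          ((vcell \<AA> x \<div> vassoc \<AA> r x v) \<parallel> vassoc \<AA> r (x \<bullet> v) x \<parallel> (vassoc \<AA> x v x \<div> vcell \<AA> r)) \<parallel>
          (vassoc_inv \<AA> x v x \<div> vcell \<AA> r)"
        by (simp add: hpaste_assoc_simp)
      also have "\<dots> = vassoc \<AA> (r \<bullet> x) v x \<parallel> vassoc \<AA> r x (v \<bullet> x) \<parallel> (vassoc_inv \<AA> x v x \<div> vcell \<AA> r)"
        by (simp add: pentagon_cells)
      finally show ?thesis by (simp add: hpaste_assoc_simp)
    qed
    have "unit (r \<bullet> x) \<parallel> (vcell \<AA> x \<div> counit r) = ((\<eta> \<div> vcell \<AA> x) \<div> vcell \<AA> r) \<parallel>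
        (vassoc_inv \<AA> r x (v \<bullet> x) \<parallel> vassoc_inv \<AA> (r \<bullet> x) v x \<parallel> (vcell \<AA> x \<div> vassoc \<AA> r x v) \<parallel>
        vassoc \<AA> r (x \<bullet> v) x) \<parallel> ((vcell \<AA> x \<div> \<epsilon>) \<div> vcell \<AA> r)"
      by (simp add: unit_def counit_def whisker_simps split slide hpaste_assoc_simp)
    also have "\<dots> = ((\<eta> \<div> vcell \<AA> x) \<parallel> vassoc_inv \<AA> x v x \<parallel> (vcell \<AA> x \<div> \<epsilon>)) \<div> vcell \<AA> r"
      unfolding middle by (simp add: whisker_simps)
    finally show ?thesis by (simp add: tri_x)
  qed
  show ?thesis
  proof (rule eqpollI_mutually_inverse[where F = "\<lambda>\<theta>. unit p \<parallel> (vcell \<AA> x \<div> \<theta>)"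
        and G = "\<lambda>\<phi>. (vcell \<AA> v \<div> \<phi>) \<parallel> counit r"])
    have [simp]: "unit p \<in> Cells \<AA>" "ctop \<AA> (unit p) = hid \<AA> (vcod \<AA> v)" "cleft \<AA> (unit p) = p"
      "cright \<AA> (unit p) = (p \<bullet> v) \<bullet> x" "cbot \<AA> (unit p) = hid \<AA> (vcod \<AA> p)"
      by (simp_all add: unit_def)
    have [simp]: "counit r \<in> Cells \<AA>" "ctop \<AA> (counit r) = hid \<AA> (vdom \<AA> v)"
      "cleft \<AA> (counit r) = (r \<bullet> x) \<bullet> v" "cright \<AA> (counit r) = r" "cbot \<AA> (counit r) = hid \<AA> (vcod \<AA> p)"
      by (simp_all add: counit_def)
    have [simp]: "counit (p \<bullet> v) \<in> Cells \<AA>" "cleft \<AA> (counit (p \<bullet> v)) = ((p \<bullet> v) \<bullet> x) \<bullet> v"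
      "cright \<AA> (counit (p \<bullet> v)) = p \<bullet> v"
      by (simp_all add: counit_def)
    have [simp]: "unit (r \<bullet> x) \<in> Cells \<AA>" "cleft \<AA> (unit (r \<bullet> x)) = r \<bullet> x"
      "cright \<AA> (unit (r \<bullet> x)) = ((r \<bullet> x) \<bullet> v) \<bullet> x"
      by (simp_all add: unit_def)
    show "unit p \<parallel> (vcell \<AA> x \<div> \<theta>) \<in> {\<phi>. globular \<AA> \<phi> p (r \<bullet> x)} \<and>
        (vcell \<AA> v \<div> (unit p \<parallel> (vcell \<AA> x \<div> \<theta>))) \<parallel> counit r = \<theta>"
      if "\<theta> \<in> {\<theta>. globular \<AA> \<theta> (p \<bullet> v) r}" for \<theta>
    proof -
      have [simp]: "\<theta> \<in> Cells \<AA>" "ctop \<AA> \<theta> = hid \<AA> (vdom \<AA> v)" "cleft \<AA> \<theta> = p \<bullet> v"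
        "cright \<AA> \<theta> = r" "cbot \<AA> \<theta> = hid \<AA> (vcod \<AA> p)"
        using that by auto
      \<comment> \<open>Naturality of the counit: interchange slides \<open>\<theta>\<close> past \<open>\<epsilon>\<close>.\<close>
      have "(vcell \<AA> v \<div> (vcell \<AA> x \<div> \<theta>)) \<parallel> counit r = counit (p \<bullet> v) \<parallel> \<theta>"
      proof -
        have "(vcell \<AA> (x \<bullet> v) \<div> \<theta>) \<parallel> (\<epsilon> \<div> vcell \<AA> r) = (\<epsilon> \<div> vcell \<AA> (p \<bullet> v)) \<parallel> \<theta>"
          using interchange_cells[of "vcell \<AA> (x \<bullet> v)" \<epsilon> \<theta> "vcell \<AA> r"]
            interchange_cells[of \<epsilon> "vcell \<AA> (vid \<AA> (vdom \<AA> v))" "vcell \<AA> (p \<bullet> v)" \<theta>] by simp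
        moreover have "(vcell \<AA> v \<div> (vcell \<AA> x \<div> \<theta>)) \<parallel> vassoc \<AA> r x v =
            vassoc \<AA> (p \<bullet> v) x v \<parallel> (vcell \<AA> (x \<bullet> v) \<div> \<theta>)"
          using vassoc_naturality[of "vcell \<AA> v" "vcell \<AA> x" \<theta>] by simp
        ultimately show ?thesis
          by (simp add: counit_def hpaste_assoc_simp flip: hpaste_assoc_simp[of _ "vassoc \<AA> r x v"])
      qed
      then have "(vcell \<AA> v \<div> (unit p \<parallel> (vcell \<AA> x \<div> \<theta>))) \<parallel> counit r =
          ((vcell \<AA> v \<div> unit p) \<parallel> counit (p \<bullet> v)) \<parallel> \<theta>"
        by (simp add: whisker_simps hpaste_assoc_simp)
      then show ?thesis by (simp add: triangle_p)
    qed
    show "(vcell \<AA> v \<div> \<phi>) \<parallel> counit r \<in> {\<theta>. globular \<AA> \<theta> (p \<bullet> v) r} \<and>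
        unit p \<parallel> (vcell \<AA> x \<div> ((vcell \<AA> v \<div> \<phi>) \<parallel> counit r)) = \<phi>"
      if "\<phi> \<in> {\<phi>. globular \<AA> \<phi> p (r \<bullet> x)}" for \<phi>
    proof -
      have [simp]: "\<phi> \<in> Cells \<AA>" "ctop \<AA> \<phi> = hid \<AA> (vcod \<AA> v)" "cleft \<AA> \<phi> = p"
        "cright \<AA> \<phi> = r \<bullet> x" "cbot \<AA> \<phi> = hid \<AA> (vcod \<AA> p)"
        using that by auto
      \<comment> \<open>Naturality of the unit: interchange slides \<open>\<phi>\<close> past \<open>\<eta>\<close>.\<close>
      have "unit p \<parallel> (vcell \<AA> x \<div> (vcell \<AA> v \<div> \<phi>)) = \<phi> \<parallel> unit (r \<bullet> x)"
      proof -
        have "(\<eta> \<div> vcell \<AA> p) \<parallel> (vcell \<AA> (v \<bullet> x) \<div> \<phi>) = \<phi> \<parallel> (\<eta> \<div> vcell \<AA> (r \<bullet> x))"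
          using interchange_cells[of \<eta> "vcell \<AA> (v \<bullet> x)" "vcell \<AA> p" \<phi>]
            interchange_cells[of "vcell \<AA> (vid \<AA> (vcod \<AA> v))" \<eta> \<phi> "vcell \<AA> (r \<bullet> x)"] by simp
        moreover have "vassoc_inv \<AA> p v x \<parallel> (vcell \<AA> x \<div> (vcell \<AA> v \<div> \<phi>)) =
            (vcell \<AA> (v \<bullet> x) \<div> \<phi>) \<parallel> vassoc_inv \<AA> (r \<bullet> x) v x"
          using vassoc_inv_naturality[of "vcell \<AA> x" "vcell \<AA> v" \<phi>] by simp
        ultimately show ?thesis
          by (simp add: unit_def hpaste_assoc_simp flip: hpaste_assoc_simp[of _ "vcell \<AA> (v \<bullet> x) \<div> \<phi>"])
      qed
      then have "unit p \<parallel> (vcell \<AA> x \<div> ((vcell \<AA> v \<div> \<phi>) \<parallel> counit r)) =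
          \<phi> \<parallel> (unit (r \<bullet> x) \<parallel> (vcell \<AA> x \<div> counit r))"
        by (simp add: whisker_simps flip: hpaste_assoc_simp)
      then show ?thesis by (simp add: triangle_r)
    qed
  qed
qed

text \<open>
  The same argument for composition on the other side, where the adjoints keep their order: now
  \<open>unit p : p \<Rightarrow> w \<bullet> (y \<bullet> p)\<close> and \<open>counit s : y \<bullet> (w \<bullet> s) \<Rightarrow> s\<close>, and the roles of the associator
  and its inverse are exchanged.
\<close>

lemma postcomposition_mate_eqpoll:
  assumes "ver_left_adjoint \<AA> y w" and "w \<in> Ver \<AA>" "y \<in> Ver \<AA>" "p \<in> Ver \<AA>" "s \<in> Ver \<AA>"
    and "vcod \<AA> p = vcod \<AA> w" "vcod \<AA> s = vdom \<AA> w" "vdom \<AA> s = vdom \<AA> p"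
  shows "{\<theta>. globular \<AA> \<theta> (y \<bullet> p) s} \<approx> {\<phi>. globular \<AA> \<phi> p (w \<bullet> s)}"
proof -
  obtain \<eta> \<epsilon> where y: "vdom \<AA> y = vcod \<AA> w" "vcod \<AA> y = vdom \<AA> w"
    and \<eta>: "\<eta> \<in> Cells \<AA>" "ctop \<AA> \<eta> = hid \<AA> (vcod \<AA> w)" "cleft \<AA> \<eta> = vid \<AA> (vcod \<AA> w)"
      "cright \<AA> \<eta> = w \<bullet> y" "cbot \<AA> \<eta> = hid \<AA> (vcod \<AA> w)"
    and \<epsilon>: "\<epsilon> \<in> Cells \<AA>" "ctop \<AA> \<epsilon> = hid \<AA> (vdom \<AA> w)" "cleft \<AA> \<epsilon> = y \<bullet> w"
      "cright \<AA> \<epsilon> = vid \<AA> (vdom \<AA> w)" "cbot \<AA> \<epsilon> = hid \<AA> (vdom \<AA> w)"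
    and tri_y: "(\<eta> \<div> vcell \<AA> y) \<parallel> vassoc_inv \<AA> y w y \<parallel> (vcell \<AA> y \<div> \<epsilon>) = vcell \<AA> y"
    and tri_w: "(vcell \<AA> w \<div> \<eta>) \<parallel> vassoc \<AA> w y w \<parallel> (\<epsilon> \<div> vcell \<AA> w) = vcell \<AA> w"
    using assms by (auto simp: ver_left_adjoint_def)
  note [simp] = y \<eta> \<epsilon> assms(2-)
  define unit where "unit p = (vcell \<AA> p \<div> \<eta>) \<parallel> vassoc \<AA> w y p" for p
  define counit where "counit s = vassoc_inv \<AA> y w s \<parallel> (vcell \<AA> s \<div> \<epsilon>)" for s
  have triangle_p: "(unit p \<div> vcell \<AA> y) \<parallel> counit (y \<bullet> p) = vcell \<AA> (y \<bullet> p)"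
  proof -
    have slide: "(vcell \<AA> p \<div> \<eta>) \<div> vcell \<AA> y =
        (vcell \<AA> p \<div> (\<eta> \<div> vcell \<AA> y)) \<parallel> vassoc \<AA> y (w \<bullet> y) p"
      using vassoc_naturality[of "vcell \<AA> p" \<eta> "vcell \<AA> y"] by simp
    have "vcell \<AA> p \<div> (vcell \<AA> y \<div> \<epsilon>) = vassoc \<AA> (y \<bullet> w) y p \<parallel> (vcell \<AA> (y \<bullet> p) \<div> \<epsilon>)"
      using vassoc_naturality[of "vcell \<AA> p" "vcell \<AA> y" \<epsilon>] by simp
    then have split: "vcell \<AA> (y \<bullet> p) \<div> \<epsilon> =
        vassoc_inv \<AA> (y \<bullet> w) y p \<parallel> (vcell \<AA> p \<div> (vcell \<AA> y \<div> \<epsilon>))"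
      by simp
    have middle: "vassoc \<AA> y (w \<bullet> y) p \<parallel> (vassoc \<AA> w y p \<div> vcell \<AA> y) \<parallel>
        vassoc_inv \<AA> y w (y \<bullet> p) \<parallel> vassoc_inv \<AA> (y \<bullet> w) y p = vcell \<AA> p \<div> vassoc_inv \<AA> y w y"
    proof -
      have "(vcell \<AA> p \<div> vassoc_inv \<AA> y w y) \<parallel> (vcell \<AA> p \<div> vassoc \<AA> y w y) =
          vcell \<AA> ((y \<bullet> (w \<bullet> y)) \<bullet> p)"
        by (simp flip: whisker_simps)
      then have "vassoc \<AA> y (w \<bullet> y) p \<parallel> (vassoc \<AA> w y p \<div> vcell \<AA> y) =
          (vcell \<AA> p \<div> vassoc_inv \<AA> y w y) \<parallel> ((vcell \<AA> p \<div> vassoc \<AA> y w y) \<parallel>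
          vassoc \<AA> y (w \<bullet> y) p \<parallel> (vassoc \<AA> w y p \<div> vcell \<AA> y))"
        by (simp flip: hpaste_assoc_simp)
      also have "\<dots> = (vcell \<AA> p \<div> vassoc_inv \<AA> y w y) \<parallel>
          (vassoc \<AA> (y \<bullet> w) y p \<parallel> vassoc \<AA> y w (y \<bullet> p))"
        by (simp add: pentagon_cells)
      finally show ?thesis by (simp add: hpaste_assoc_simp)
    qed
    have "(unit p \<div> vcell \<AA> y) \<parallel> counit (y \<bullet> p) = (vcell \<AA> p \<div> (\<eta> \<div> vcell \<AA> y)) \<parallel>
        (vassoc \<AA> y (w \<bullet> y) p \<parallel> (vassoc \<AA> w y p \<div> vcell \<AA> y) \<parallel>
        vassoc_inv \<AA> y w (y \<bullet> p) \<parallel> vassoc_inv \<AA> (y \<bullet> w) y p) \<parallel> (vcell \<AA> p \<div> (vcell \<AA> y \<div> \<epsilon>))"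
      by (simp add: unit_def counit_def whisker_simps split slide hpaste_assoc_simp)
    also have "\<dots> = vcell \<AA> p \<div> ((\<eta> \<div> vcell \<AA> y) \<parallel> vassoc_inv \<AA> y w y \<parallel> (vcell \<AA> y \<div> \<epsilon>))"
      unfolding middle by (simp add: whisker_simps)
    finally show ?thesis by (simp add: tri_y)
  qed
  have triangle_s: "unit (w \<bullet> s) \<parallel> (counit s \<div> vcell \<AA> w) = vcell \<AA> (w \<bullet> s)"
  proof -
    have split: "vcell \<AA> (w \<bullet> s) \<div> \<eta> = (vcell \<AA> s \<div> (vcell \<AA> w \<div> \<eta>)) \<parallel> vassoc \<AA> (w \<bullet> y) w s"
      using vassoc_naturality[of "vcell \<AA> s" "vcell \<AA> w" \<eta>] by simp
    have "vcell \<AA> s \<div> (\<epsilon> \<div> vcell \<AA> w) =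
        vassoc \<AA> w (y \<bullet> w) s \<parallel> ((vcell \<AA> s \<div> \<epsilon>) \<div> vcell \<AA> w)"
      using vassoc_naturality[of "vcell \<AA> s" \<epsilon> "vcell \<AA> w"] by simp
    then have slide: "(vcell \<AA> s \<div> \<epsilon>) \<div> vcell \<AA> w =
        vassoc_inv \<AA> w (y \<bullet> w) s \<parallel> (vcell \<AA> s \<div> (\<epsilon> \<div> vcell \<AA> w))"
      by simp
    have middle: "vassoc \<AA> (w \<bullet> y) w s \<parallel> vassoc \<AA> w y (w \<bullet> s) \<parallel>
        (vassoc_inv \<AA> y w s \<div> vcell \<AA> w) \<parallel> vassoc_inv \<AA> w (y \<bullet> w) s = vcell \<AA> s \<div> vassoc \<AA> w y w"
    proof -
      have "(vassoc \<AA> y w s \<div> vcell \<AA> w) \<parallel> (vassoc_inv \<AA> y w s \<div> vcell \<AA> w) =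
          vcell \<AA> (w \<bullet> ((y \<bullet> w) \<bullet> s))"
        by (simp flip: whisker_simps)
      then show ?thesis by (simp add: pentagon_cells hpaste_assoc_simp)
    qed
    have "unit (w \<bullet> s) \<parallel> (counit s \<div> vcell \<AA> w) = (vcell \<AA> s \<div> (vcell \<AA> w \<div> \<eta>)) \<parallel>
        (vassoc \<AA> (w \<bullet> y) w s \<parallel> vassoc \<AA> w y (w \<bullet> s) \<parallel>
        (vassoc_inv \<AA> y w s \<div> vcell \<AA> w) \<parallel> vassoc_inv \<AA> w (y \<bullet> w) s) \<parallel>
        (vcell \<AA> s \<div> (\<epsilon> \<div> vcell \<AA> w))"
      by (simp add: unit_def counit_def whisker_simps split slide hpaste_assoc_simp)
    also have "\<dots> = vcell \<AA> s \<div> ((vcell \<AA> w \<div> \<eta>) \<parallel> vassoc \<AA> w y w \<parallel> (\<epsilon> \<div> vcell \<AA> w))"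
      unfolding middle by (simp add: whisker_simps)
    finally show ?thesis by (simp add: tri_w)
  qed
  show ?thesis
  proof (rule eqpollI_mutually_inverse[where F = "\<lambda>\<theta>. unit p \<parallel> (\<theta> \<div> vcell \<AA> w)"
        and G = "\<lambda>\<phi>. (\<phi> \<div> vcell \<AA> y) \<parallel> counit s"])
    have [simp]: "unit p \<in> Cells \<AA>" "ctop \<AA> (unit p) = hid \<AA> (vdom \<AA> p)" "cleft \<AA> (unit p) = p"
      "cright \<AA> (unit p) = w \<bullet> (y \<bullet> p)" "cbot \<AA> (unit p) = hid \<AA> (vcod \<AA> w)"
      by (simp_all add: unit_def)
    have [simp]: "counit s \<in> Cells \<AA>" "ctop \<AA> (counit s) = hid \<AA> (vdom \<AA> p)"
      "cleft \<AA> (counit s) = y \<bullet> (w \<bullet> s)" "cright \<AA> (counit s) = s" "cbot \<AA> (counit s) = hid \<AA> (vdom \<AA> w)"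
      by (simp_all add: counit_def)
    have [simp]: "counit (y \<bullet> p) \<in> Cells \<AA>" "cleft \<AA> (counit (y \<bullet> p)) = y \<bullet> (w \<bullet> (y \<bullet> p))"
      "cright \<AA> (counit (y \<bullet> p)) = y \<bullet> p"
      by (simp_all add: counit_def)
    have [simp]: "unit (w \<bullet> s) \<in> Cells \<AA>" "cleft \<AA> (unit (w \<bullet> s)) = w \<bullet> s"
      "cright \<AA> (unit (w \<bullet> s)) = w \<bullet> (y \<bullet> (w \<bullet> s))"
      by (simp_all add: unit_def)
    show "unit p \<parallel> (\<theta> \<div> vcell \<AA> w) \<in> {\<phi>. globular \<AA> \<phi> p (w \<bullet> s)} \<and>
        ((unit p \<parallel> (\<theta> \<div> vcell \<AA> w)) \<div> vcell \<AA> y) \<parallel> counit s = \<theta>"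
      if "\<theta> \<in> {\<theta>. globular \<AA> \<theta> (y \<bullet> p) s}" for \<theta>
    proof -
      have [simp]: "\<theta> \<in> Cells \<AA>" "ctop \<AA> \<theta> = hid \<AA> (vdom \<AA> p)" "cleft \<AA> \<theta> = y \<bullet> p"
        "cright \<AA> \<theta> = s" "cbot \<AA> \<theta> = hid \<AA> (vdom \<AA> w)"
        using that by auto
      \<comment> \<open>Naturality of the counit: interchange slides \<open>\<theta>\<close> past \<open>\<epsilon>\<close>.\<close>
      have "((\<theta> \<div> vcell \<AA> w) \<div> vcell \<AA> y) \<parallel> counit s = counit (y \<bullet> p) \<parallel> \<theta>"
      proof -
        have "(\<theta> \<div> vcell \<AA> (y \<bullet> w)) \<parallel> (vcell \<AA> s \<div> \<epsilon>) = (vcell \<AA> (y \<bullet> p) \<div> \<epsilon>) \<parallel> \<theta>"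
          using interchange_cells[of \<theta> "vcell \<AA> s" "vcell \<AA> (y \<bullet> w)" \<epsilon>]
            interchange_cells[of "vcell \<AA> (y \<bullet> p)" \<theta> \<epsilon> "vcell \<AA> (vid \<AA> (vdom \<AA> w))"] by simp
        moreover have "((\<theta> \<div> vcell \<AA> w) \<div> vcell \<AA> y) \<parallel> vassoc_inv \<AA> y w s =
            vassoc_inv \<AA> y w (y \<bullet> p) \<parallel> (\<theta> \<div> vcell \<AA> (y \<bullet> w))"
          using vassoc_inv_naturality[of \<theta> "vcell \<AA> w" "vcell \<AA> y"] by simp
        ultimately show ?thesis
          by (simp add: counit_def hpaste_assoc_simp flip: hpaste_assoc_simp[of _ "vassoc_inv \<AA> y w s"])
      qed
      then have "((unit p \<parallel> (\<theta> \<div> vcell \<AA> w)) \<div> vcell \<AA> y) \<parallel> counit s =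
          ((unit p \<div> vcell \<AA> y) \<parallel> counit (y \<bullet> p)) \<parallel> \<theta>"
        by (simp add: whisker_simps hpaste_assoc_simp)
      then show ?thesis by (simp add: triangle_p)
    qed
    show "(\<phi> \<div> vcell \<AA> y) \<parallel> counit s \<in> {\<theta>. globular \<AA> \<theta> (y \<bullet> p) s} \<and>
        unit p \<parallel> (((\<phi> \<div> vcell \<AA> y) \<parallel> counit s) \<div> vcell \<AA> w) = \<phi>"
      if "\<phi> \<in> {\<phi>. globular \<AA> \<phi> p (w \<bullet> s)}" for \<phi>
    proof -
      have [simp]: "\<phi> \<in> Cells \<AA>" "ctop \<AA> \<phi> = hid \<AA> (vdom \<AA> p)" "cleft \<AA> \<phi> = p"
        "cright \<AA> \<phi> = w \<bullet> s" "cbot \<AA> \<phi> = hid \<AA> (vcod \<AA> w)"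
        using that by auto
      \<comment> \<open>Naturality of the unit: interchange slides \<open>\<phi>\<close> past \<open>\<eta>\<close>.\<close>
      have "unit p \<parallel> ((\<phi> \<div> vcell \<AA> y) \<div> vcell \<AA> w) = \<phi> \<parallel> unit (w \<bullet> s)"
      proof -
        have "(vcell \<AA> p \<div> \<eta>) \<parallel> (\<phi> \<div> vcell \<AA> (w \<bullet> y)) = \<phi> \<parallel> (vcell \<AA> (w \<bullet> s) \<div> \<eta>)"
          using interchange_cells[of "vcell \<AA> p" \<phi> \<eta> "vcell \<AA> (w \<bullet> y)"]
            interchange_cells[of \<phi> "vcell \<AA> (w \<bullet> s)" "vcell \<AA> (vid \<AA> (vcod \<AA> w))" \<eta>] by simp
        moreover have "vassoc \<AA> w y p \<parallel> ((\<phi> \<div> vcell \<AA> y) \<div> vcell \<AA> w) =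
            (\<phi> \<div> vcell \<AA> (w \<bullet> y)) \<parallel> vassoc \<AA> w y (w \<bullet> s)"
          using vassoc_naturality[of \<phi> "vcell \<AA> y" "vcell \<AA> w"] by simp
        ultimately show ?thesis
          by (simp add: unit_def hpaste_assoc_simp flip: hpaste_assoc_simp[of _ "\<phi> \<div> vcell \<AA> (w \<bullet> y)"])
      qed
      then have "unit p \<parallel> (((\<phi> \<div> vcell \<AA> y) \<parallel> counit s) \<div> vcell \<AA> w) =
          \<phi> \<parallel> (unit (w \<bullet> s) \<parallel> (counit s \<div> vcell \<AA> w))"
        by (simp add: whisker_simps flip: hpaste_assoc_simp)
      then show ?thesis by (simp add: triangle_s)
    qed
  qed
qed

lemma reassociate_target_eqpoll:
  assumes "u \<in> Ver \<AA>" "v \<in> Ver \<AA>" "w \<in> Ver \<AA>" "vcod \<AA> u = vdom \<AA> v" "vcod \<AA> v = vdom \<AA> w"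
    and "p \<in> Ver \<AA>" "vdom \<AA> p = vdom \<AA> u" "vcod \<AA> p = vcod \<AA> w"
  shows "{\<theta>. globular \<AA> \<theta> p ((w \<bullet> v) \<bullet> u)} \<approx> {\<theta>. globular \<AA> \<theta> p (w \<bullet> (v \<bullet> u))}"
  by (rule eqpollI_mutually_inverse[where F = "\<lambda>\<theta>. \<theta> \<parallel> vassoc \<AA> w v u"
        and G = "\<lambda>\<theta>. \<theta> \<parallel> vassoc_inv \<AA> w v u"]) (use assms in \<open>auto simp: hpaste_assoc_simp\<close>)

end

section \<open>Cells and retrocells\<close>

context double_category_with_companions
begin

theorem cells_eqpoll_vertical_retrocells:
  assumes f: "harr \<AA> f A B" and g: "harr \<AA> g C D" and v: "varr \<AA> v A C" and w: "varr \<AA> w B D"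
    and x: "varr \<AA> x C A" "ver_left_adjoint \<AA> x v" and y: "varr \<AA> y D B" "ver_left_adjoint \<AA> y w"
  shows "{\<alpha>. cell \<AA> \<alpha> f v w g} \<approx> {\<beta>. retrocell \<AA> \<beta> g x y f}"
proof -
  let ?f = "companion \<AA> f" and ?g = "companion \<AA> g"
  note [simp] = f[simplified] g[simplified] v[simplified] w[simplified]
    x(1)[simplified] y(1)[simplified]
  have comp_f: "is_companion \<AA> f ?f (psi \<AA> f) (chi \<AA> f)"
    and comp_g: "is_companion \<AA> g ?g (psi \<AA> g) (chi \<AA> g)"
    by (simp_all add: companion_is_companion)
  have [simp]: "?f \<in> Ver \<AA>" "vdom \<AA> ?f = A" "vcod \<AA> ?f = B" "?g \<in> Ver \<AA>" "vdom \<AA> ?g = C" "vcod \<AA> ?g = D"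
    using comp_f comp_g by (auto simp: is_companion_def)
  have "{\<alpha>. cell \<AA> \<alpha> f v w g} \<approx> {\<alpha>. cell \<AA> \<alpha> (hid \<AA> A) v (w \<bullet> ?f) g}"
    by (rule companion_top_eqpoll[OF comp_f]) simp_all
  also have "\<dots> \<approx> {\<alpha>. cell \<AA> \<alpha> (hid \<AA> A) (?g \<bullet> v) (w \<bullet> ?f) (hid \<AA> D)}"
    by (rule companion_bottom_eqpoll[OF comp_g]) simp_all
  also have "\<dots> = {\<theta>. globular \<AA> \<theta> (?g \<bullet> v) (w \<bullet> ?f)}"
    by auto
  also have "\<dots> \<approx> {\<theta>. globular \<AA> \<theta> ?g ((w \<bullet> ?f) \<bullet> x)}"
    by (rule precomposition_mate_eqpoll[OF x(2)]) simp_all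
  also have "\<dots> \<approx> {\<theta>. globular \<AA> \<theta> ?g (w \<bullet> (?f \<bullet> x))}"
    by (rule reassociate_target_eqpoll) simp_all
  also have "\<dots> \<approx> {\<theta>. globular \<AA> \<theta> (y \<bullet> ?g) (?f \<bullet> x)}"
    by (rule eqpoll_sym, rule postcomposition_mate_eqpoll[OF y(2)]) simp_all
  also have "\<dots> = {\<beta>. retrocell \<AA> \<beta> g x y f}"
    by (auto simp: retrocell_def)
  finally show ?thesis .
qed

theorem cells_eqpoll_horizontal_retrocells:
  assumes f: "harr \<AA> f A B" and g: "harr \<AA> g C D" and v: "varr \<AA> v A C" and w: "varr \<AA> w B D"
    and h: "harr \<AA> h B A" "hor_left_adjoint \<AA> h f" and k: "harr \<AA> k D C" "hor_left_adjoint \<AA> k g"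
  shows "{\<alpha>. cell \<AA> \<alpha> f v w g} \<approx> {\<gamma>. retrocell \<AA> \<gamma> h w v k}"
proof -
  let ?h = "companion \<AA> h" and ?k = "companion \<AA> k"
  note [simp] = f[simplified] g[simplified] v[simplified] w[simplified]
    h(1)[simplified] k(1)[simplified]
  have comp_h: "is_companion \<AA> h ?h (psi \<AA> h) (chi \<AA> h)"
    and comp_k: "is_companion \<AA> k ?k (psi \<AA> k) (chi \<AA> k)"
    by (simp_all add: companion_is_companion)
  have [simp]: "?h \<in> Ver \<AA>" "vdom \<AA> ?h = B" "vcod \<AA> ?h = A" "?k \<in> Ver \<AA>" "vdom \<AA> ?k = D" "vcod \<AA> ?k = C"
    using comp_h comp_k by (auto simp: is_companion_def)
  obtain \<zeta> \<xi> where conj_f: "is_conjoint \<AA> f ?h \<zeta> \<xi>"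
    using conjoint_of_companion_of_left_adjoint[OF comp_h h(2)] by blast
  obtain \<zeta>' \<xi>' where conj_g: "is_conjoint \<AA> g ?k \<zeta>' \<xi>'"
    using conjoint_of_companion_of_left_adjoint[OF comp_k k(2)] by blast
  have "{\<alpha>. cell \<AA> \<alpha> f v w g} \<approx> {\<alpha>. cell \<AA> \<alpha> (hid \<AA> B) (v \<bullet> ?h) w g}"
    by (rule conjoint_top_eqpoll[OF conj_f]) simp_all
  also have "\<dots> \<approx> {\<alpha>. cell \<AA> \<alpha> (hid \<AA> B) (v \<bullet> ?h) (?k \<bullet> w) (hid \<AA> C)}"
    by (rule conjoint_bottom_eqpoll[OF conj_g]) simp_all
  also have "\<dots> = {\<gamma>. retrocell \<AA> \<gamma> h w v k}"
    by (auto simp: retrocell_def)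
  finally show ?thesis .
qed

end

theorem theorem3p1:
  fixes \<AA> :: "('o, 'h, 'v, 'c, 'm) companion_double_cat_scheme"
    and A B C D :: 'o and f g :: 'h and v w :: 'v
  assumes "double_category_with_companions \<AA>"
    and "harr \<AA> f A B" and "harr \<AA> g C D"
    and "varr \<AA> v A C" and "varr \<AA> w B D"
  shows "(\<forall>x y. varr \<AA> x C A \<and> ver_left_adjoint \<AA> x v \<and> varr \<AA> y D B \<and> ver_left_adjoint \<AA> y w
            \<longrightarrow> (\<exists>\<Phi>. bij_betw \<Phi> {\<alpha>. cell \<AA> \<alpha> f v w g} {\<beta>. retrocell \<AA> \<beta> g x y f}))
       \<and> (\<forall>h k. harr \<AA> h B A \<and> hor_left_adjoint \<AA> h f \<and> harr \<AA> k D C \<and> hor_left_adjoint \<AA> k g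
            \<longrightarrow> (\<exists>\<Phi>. bij_betw \<Phi> {\<alpha>. cell \<AA> \<alpha> f v w g} {\<gamma>. retrocell \<AA> \<gamma> h w v k}))"
proof -
  interpret double_category_with_companions \<AA> by fact
  show ?thesis
    using cells_eqpoll_vertical_retrocells[OF assms(2-5)]
      cells_eqpoll_horizontal_retrocells[OF assms(2-5)]
    unfolding eqpoll_def by blast
qed

end
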